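(* Let $\{\lambda_n\}_{n\ge 1}$ be a strictly increasing sequence of stopping times (fixed rules $\lambda_n:\{0,1\}^{\mathbb{N}}\to\mathbb{N}$, where $\mathbb N=\{0,1,2,\dots\}$, such that for each $k$ the event $\{\lambda_n=k\}$ depends only on $(x_0,\dots,x_k)$; these rules are applied to the sample path $(X_0,X_1,\dots)$ of whatever process is observed) with the following property: for every stationary and ergodic binary Markov chain $\{X_n\}$ of some (arbitrary) finite order, almost surely $\lambda_{n+1}=\lambda_n+1$ for all sufficiently large $n$. Let $\{h_n\}_{n\ge 1}$ be any sequence of estimators, where $h_n$ is a function of the observed data segment $(X_0,\dots,X_{\lambda_n})$ taking values in $\mathbb{R}$. Then there exists a stationary and ergodic binary time series $\{X_n\}_{n=-\infty}^{\infty}$ whose conditional probability $P(X_1=1\mid \dots,X_{-1},X_0)$ is almost surely continuous, such that $$ P\left( \limsup_{n\to\infty} \left| h_n(X_0,\dots,X_{\lambda_n})- P(X_{\lambda_n+1}=1\mid X_0,\dots,X_{\lambda_n})\right|>0 \right) >0 . $$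
   Context: A binary time series takes values in $\{0,1\}$; a stationary one-sided series $\{X_n\}_{n\ge 0}$ is identified with its two-sided stationary extension $\{X_n\}_{n=-\infty}^{\infty}$. A binary Markov chain of finite order $K$ is a binary process for which $P(X_n=1\mid X_0,\dots,X_{n-1})$ depends only on $(X_{n-K},\dots,X_{n-1})$. Let $\mathcal{X}^{*-}=\{(\dots,x_{-1},x_0): x_i\in\{0,1\}\text{ for all } i\le 0\}$ with the metric $d^*((\dots,x_{-1},x_0),(\dots,y_{-1},y_0))=\sum_{i=0}^{\infty}2^{-i-1}|x_{-i}-y_{-i}|$. The conditional probability $P(X_1=1\mid \dots,X_{-1},X_0)$ is called almost surely continuous if there is a set $C\subseteq\mathcal{X}^{*-}$ with $P((\dots,X_{-1},X_0)\in C)=1$ such that the restriction of the function $(\dots,x_{-1},x_0)\mapsto P(X_1=1\mid \dots,X_{-1}=x_{-1},X_0=x_0)$ to $C$ is continuous with respect to $d^*$. *)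

theory Defs
  imports "HOL-Probability.Probability"
begin

text \<open>Binary time series are represented by their (two-sided) law: a probability
measure on the product space of functions int => bool.  X_i is coordinate i.\<close>

definition BS :: "(int \<Rightarrow> bool) measure" where
  "BS = PiM UNIV (\<lambda>_. count_space UNIV)"

definition BS1 :: "(nat \<Rightarrow> bool) measure" where
  "BS1 = PiM UNIV (\<lambda>_. count_space UNIV)"

definition binary_ts :: "(int \<Rightarrow> bool) measure \<Rightarrow> bool" where
  "binary_ts \<mu> \<longleftrightarrow> prob_space \<mu> \<and> sets \<mu> = sets BS"

definition shift :: "(int \<Rightarrow> bool) \<Rightarrow> int \<Rightarrow> bool" where
  "shift x = (\<lambda>i. x (i + 1))"

definition stationary :: "(int \<Rightarrow> bool) measure \<Rightarrow> bool" where
  "stationary \<mu> \<longleftrightarrow> binary_ts \<mu> \<and>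
     (\<forall>A \<in> sets \<mu>. measure \<mu> (shift -` A) = measure \<mu> A)"

definition ergodic :: "(int \<Rightarrow> bool) measure \<Rightarrow> bool" where
  "ergodic \<mu> \<longleftrightarrow> (\<forall>A \<in> sets \<mu>. shift -` A = A \<longrightarrow>
     measure \<mu> A = 0 \<or> measure \<mu> A = 1)"

definition path :: "(int \<Rightarrow> bool) \<Rightarrow> nat \<Rightarrow> bool" where
  "path x = (\<lambda>n. x (int n))"

definition past :: "(int \<Rightarrow> bool) \<Rightarrow> nat \<Rightarrow> bool" where
  "past x = (\<lambda>i. x (- int i))"

definition markov_finite_order :: "(int \<Rightarrow> bool) measure \<Rightarrow> bool" where
  "markov_finite_order \<mu> \<longleftrightarrow> (\<exists>(K::nat) (p :: bool list \<Rightarrow> real).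
     \<forall>n \<ge> K. \<forall>w :: nat \<Rightarrow> bool.
       measure \<mu> {x. (\<forall>i<n. x (int i) = w i) \<and> x (int n)}
         = p (map w [n - K..<n]) * measure \<mu> {x. \<forall>i<n. x (int i) = w i})"

definition stopping_seq :: "(nat \<Rightarrow> (nat \<Rightarrow> bool) \<Rightarrow> nat) \<Rightarrow> bool" where
  "stopping_seq lam \<longleftrightarrow>
     (\<forall>n\<ge>1. \<forall>x y. (\<forall>i \<le> lam n x. x i = y i) \<longrightarrow> lam n y = lam n x) \<and>
     (\<forall>n\<ge>1. \<forall>x. lam n x < lam (Suc n) x)"

text \<open>P(X_{k+1} = 1 | X_0..X_k) evaluated along the path x (elementary conditional
  probability; for a stopping time this is the conditional probability given the
  stopped segment on the event lambda_n = k).\<close>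
definition pcond :: "(int \<Rightarrow> bool) measure \<Rightarrow> nat \<Rightarrow> (nat \<Rightarrow> bool) \<Rightarrow> real" where
  "pcond \<mu> k x =
     measure \<mu> {y. (\<forall>i\<le>k. y (int i) = x i) \<and> y (int (Suc k))} /
     measure \<mu> {y. \<forall>i\<le>k. y (int i) = x i}"

definition dstar :: "(nat \<Rightarrow> bool) \<Rightarrow> (nat \<Rightarrow> bool) \<Rightarrow> real" where
  "dstar a b = (\<Sum>i. (1/2) ^ (i + 1) * (if a i = b i then 0 else 1))"

definition dstar_continuous_on :: "(nat \<Rightarrow> bool) set \<Rightarrow> ((nat \<Rightarrow> bool) \<Rightarrow> real) \<Rightarrow> bool" where
  "dstar_continuous_on C g \<longleftrightarrow>
     (\<forall>a\<in>C. \<forall>e>0. \<exists>d>0. \<forall>b\<in>C. dstar a b < d \<longrightarrow> \<bar>g b - g a\<bar> < e)"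

definition cond_prob_version :: "(int \<Rightarrow> bool) measure \<Rightarrow> ((nat \<Rightarrow> bool) \<Rightarrow> real) \<Rightarrow> bool" where
  "cond_prob_version \<mu> g \<longleftrightarrow> g \<in> borel_measurable BS1 \<and>
     integrable \<mu> (\<lambda>x. g (past x)) \<and>
     (\<forall>B \<in> sets BS1. (\<integral>x. indicator {x. past x \<in> B} x * g (past x) \<partial>\<mu>)
                       = measure \<mu> {x. past x \<in> B \<and> x 1})"

definition as_continuous :: "(int \<Rightarrow> bool) measure \<Rightarrow> bool" where
  "as_continuous \<mu> \<longleftrightarrow> (\<exists>g C. cond_prob_version \<mu> g \<and>
     (AE x in \<mu>. past x \<in> C) \<and> dstar_continuous_on C g)"

end

theory Submission
  imports Defs
begin

text \<open>
  We use renewal processes in which the probability of a renewal (a 1) at the next step is 2/3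
  if the age, the time since the last renewal, lies in a set S, and 1/3 otherwise. Driven by i.i.d.
  noise uniform on 0, 1, 2, these processes are factors of a Bernoulli shift, hence stationary and
  ergodic; their conditional probability is a function of the age and hence continuous off a null
  set; and for finite S they are Markov chains of finite order.

  The set S is built adversarially. If S is finite, the stopping times eventually observe
  every time, so for a large level L the first time at which the age reaches L is observed with
  probability bounded below (conditionally on a renewal at time 0). Up to that time the decision
  whether L belongs to S has not influenced the path; we make the decision so that the next
  conditional probability, 1/3 or 2/3, lies on the wrong side of the estimate with probability at
  least 1/8. Later levels do not affect this event, and the reverse Fatou lemma shows that for the
  union of these finite sets infinitely many errors of size at least 1/6 occur with probability at
  least 1/8.
\<close>

subsection \<open>Product measures and ergodicity of i.i.d. noise\<close>

text \<open>Pointwise invariance stands in for membership in the sigma-algebra generated by the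
  coordinates in \<open>J\<close>; measurability in the full product is stated separately.\<close>

definition depends_on :: "('i \<Rightarrow> 'a) set \<Rightarrow> 'i set \<Rightarrow> bool" where
  "depends_on A J \<longleftrightarrow> (\<forall>u v. (\<forall>i\<in>J. u i = v i) \<longrightarrow> u \<in> A \<longleftrightarrow> v \<in> A)"

lemma depends_onI:
  assumes "\<And>u v. (\<And>i. i \<in> J \<Longrightarrow> u i = v i) \<Longrightarrow> u \<in> A \<Longrightarrow> v \<in> A"
  shows "depends_on A J"
  unfolding depends_on_def
proof (intro allI impI)
  fix u v :: "'a \<Rightarrow> 'b"
  assume "\<forall>i\<in>J. u i = v i"
  then show "u \<in> A \<longleftrightarrow> v \<in> A"
    using assms[of u v] assms[of v u] by auto
qed

lemma measurable_PiM_merge: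
  "(\<lambda>(u, v) i. if i \<in> J then u i else v i)
    \<in> measurable (PiM UNIV M \<Otimes>\<^sub>M PiM UNIV M) (PiM UNIV M)"
proof (rule measurable_PiM_single')
  fix i
  show "(\<lambda>w. (case w of (u, v) \<Rightarrow> \<lambda>i. if i \<in> J then u i else v i) i)
      \<in> measurable (PiM UNIV M \<Otimes>\<^sub>M PiM UNIV M) (M i)"
    by (cases "i \<in> J") (simp_all add: case_prod_beta)
qed (auto simp: space_PiM space_pair_measure PiE_iff)

text \<open>Splicing two independent samples along \<open>J\<close> gives again a sample of the
  product: on a finite cylinder the product over \<open>K\<close> splits into the factors inside and
  outside \<open>J\<close>. The set \<open>J\<close> may be infinite, as needed for the whole
  past.\<close>

lemma distr_PiM_merge:
  fixes M :: "'i \<Rightarrow> 'a measure" and J :: "'i set"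
  assumes "\<And>i. prob_space (M i)"
  shows "distr (PiM UNIV M \<Otimes>\<^sub>M PiM UNIV M) (PiM UNIV M) (\<lambda>(u, v) i. if i \<in> J then u i else v i)
    = PiM UNIV M" (is "distr ?P2 ?P ?f = ?P")
proof (rule measure_eqI_PiM_infinite[symmetric, OF refl])
  interpret M: product_prob_space M UNIV
    using assms unfolding product_prob_space_def product_prob_space_axioms_def product_sigma_finite_def
    by (auto intro: prob_space_imp_sigma_finite)
  interpret PP: pair_prob_space ?P ?P ..
  note f = measurable_PiM_merge[of J M]
  show "sets (distr ?P2 ?P ?f) = sets ?P" by simp
  show "finite_measure ?P" by unfold_locales
  fix A K assume K: "finite K" "K \<subseteq> (UNIV :: 'i set)" and A: "\<And>i. i \<in> K \<Longrightarrow> A i \<in> sets (M i)"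
  define B C where "B = {u \<in> space ?P. \<forall>i\<in>K \<inter> J. u i \<in> A i}"
    and "C = {u \<in> space ?P. \<forall>i\<in>K - J. u i \<in> A i}"
  have [measurable]: "B \<in> sets ?P" "C \<in> sets ?P"
    unfolding B_def C_def using K A by (auto intro!: sets.sets_Collect_finite_All)
  have "emeasure (distr ?P2 ?P ?f) (prod_emb UNIV M K (Pi\<^sub>E K A))
     = emeasure ?P2 (?f -` prod_emb UNIV M K (Pi\<^sub>E K A) \<inter> space ?P2)"
    using K A by (intro emeasure_distr f sets_PiM_I) auto
  also have "?f -` prod_emb UNIV M K (Pi\<^sub>E K A) \<inter> space ?P2 = B \<times> C"
    unfolding B_def C_def
    by (auto simp: prod_emb_iff space_pair_measure space_PiM PiE_iff split: if_splits)
  also have "emeasure ?P2 (B \<times> C) = emeasure ?P B * emeasure ?P C"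
    by (rule M.emeasure_pair_measure_Times) auto
  also have "\<dots> = (\<Prod>i\<in>K \<inter> J. emeasure (M i) (A i)) * (\<Prod>i\<in>K - J. emeasure (M i) (A i))"
    unfolding B_def C_def using K A by (subst (1 2) M.emeasure_PiM_Collect) auto
  also have "\<dots> = (\<Prod>i\<in>K. emeasure (M i) (A i))"
    using K by (subst prod.union_disjoint[symmetric]) (auto intro!: prod.cong)
  also have "\<dots> = emeasure ?P (prod_emb UNIV M K (Pi\<^sub>E K A))"
    using K A by (subst M.emeasure_PiM_emb) auto
  finally show "emeasure ?P (prod_emb UNIV M K (Pi\<^sub>E K A))
    = emeasure (distr ?P2 ?P ?f) (prod_emb UNIV M K (Pi\<^sub>E K A))" ..
qed

text \<open>In a spliced sample the first component alone decides \<open>A\<close> and the second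
  alone decides \<open>B\<close>, so the preimage of the intersection is a rectangle.\<close>

lemma measure_PiM_Int_indep:
  fixes M :: "'i \<Rightarrow> 'a measure"
  assumes M: "\<And>i. prob_space (M i)"
    and [measurable]: "A \<in> sets (PiM UNIV M)" "B \<in> sets (PiM UNIV M)"
    and AB: "depends_on A J" "depends_on B K" "J \<inter> K = {}"
  shows "measure (PiM UNIV M) (A \<inter> B) = measure (PiM UNIV M) A * measure (PiM UNIV M) B"
proof -
  let ?P = "PiM UNIV M" and ?f = "\<lambda>(u, v) i. if i \<in> J then u i else v i"
  interpret P: prob_space ?P
    using M by (rule prob_space_PiM)
  interpret PP: pair_prob_space ?P ?P ..
  note f = measurable_PiM_merge[of J M]
  have "measure ?P (A \<inter> B) = measure (distr (?P \<Otimes>\<^sub>M ?P) ?P ?f) (A \<inter> B)"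
    by (simp add: distr_PiM_merge M)
  also have "\<dots> = measure (?P \<Otimes>\<^sub>M ?P) (?f -` (A \<inter> B) \<inter> space (?P \<Otimes>\<^sub>M ?P))"
    by (intro measure_distr f) auto
  also have "?f -` (A \<inter> B) \<inter> space (?P \<Otimes>\<^sub>M ?P) = A \<times> B"
  proof -
    have "?f (u, v) \<in> A \<longleftrightarrow> u \<in> A" for u v
      using AB(1) unfolding depends_on_def by auto
    moreover have "?f (u, v) \<in> B \<longleftrightarrow> v \<in> B" for u v
    proof -
      have "\<forall>i\<in>K. ?f (u, v) i = v i" using AB(3) by auto
      then show ?thesis using AB(2) unfolding depends_on_def by blast
    qed
    ultimately show ?thesis
      using sets.sets_into_space[of A ?P] sets.sets_into_space[of B ?P]
      by (auto simp: space_pair_measure)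
  qed
  also have "measure (?P \<Otimes>\<^sub>M ?P) (A \<times> B) = measure ?P A * measure ?P B"
    by (simp add: measure_def P.emeasure_pair_measure_Times enn2real_mult)
  finally show ?thesis .
qed

section \<open>Noise indexed by the integers: translations and the zero-one law\<close>

definition lshift :: "(int \<Rightarrow> 'a) \<Rightarrow> int \<Rightarrow> 'a" where
  "lshift u = (\<lambda>i. u (i + 1))"

locale iid_noise = prob_space M for M :: "'a measure" +
  assumes space_UNIV [simp]: "space M = UNIV"
begin

abbreviation noise :: "(int \<Rightarrow> 'a) measure" where
  "noise \<equiv> PiM UNIV (\<lambda>_. M)"

sublocale noise: prob_space noise
  by (intro prob_space_PiM) unfold_locales

interpretation prod: product_prob_space "\<lambda>_::int. M" UNIV
  by unfold_locales

lemma measurable_translate [measurable]: "(\<lambda>u i. u (i + c)) \<in> measurable noise noise"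
  by (rule measurable_PiM_single') (auto simp: space_PiM)

lemma distr_translate: "distr noise noise (\<lambda>u i. u (i + c)) = noise"
  using distr_PiM_reindex[of UNIV "\<lambda>_. M" "\<lambda>i. i + c" UNIV]
  by (simp add: prob_space_axioms restrict_def)

lemma prob_translate:
  assumes [measurable]: "A \<in> sets noise"
  shows "measure noise ((\<lambda>u i. u (i + c)) -` A \<inter> space noise) = measure noise A"
  by (subst (2) distr_translate[of c, symmetric]) (auto simp: measure_distr)

lemma space_noise [simp]: "space noise = UNIV"
  by (simp add: space_PiM)

lemma measure_noise_cylinder:
  assumes J: "finite J" and X: "\<And>i. i \<in> J \<Longrightarrow> X i \<in> sets M"
  shows "measure noise {u. \<forall>i\<in>J. u i \<in> X i} = (\<Prod>i\<in>J. measure M (X i))"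
proof -
  have "emeasure noise {u. \<forall>i\<in>J. u i \<in> X i} = (\<Prod>i\<in>J. emeasure M (X i))"
    using prod.emeasure_PiM_Collect[OF _ J, of X] X by simp
  then show ?thesis
    by (simp add: noise.emeasure_eq_measure emeasure_eq_measure prod_ennreal prod_nonneg)
qed

text \<open>Sets that can be approximated by finitely determined ones form a sigma-algebra
  containing the coordinate events. A countable union is first cut off at \<open>n\<close> terms,
  and then each term is approximated.\<close>

lemma finite_approx:
  assumes "A \<in> sets noise" "e > 0"
  shows "\<exists>C J. C \<in> sets noise \<and> finite J \<and> depends_on C J \<and>
    measure noise ((A - C) \<union> (C - A)) < e"
proof -
  have "A \<in> sigma_sets UNIV {{f. f i \<in> B} | i B. B \<in> sets M}"
    using assms(1) unfolding sets_PiM_single by simp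
  then show ?thesis using \<open>e > 0\<close>
  proof (induction arbitrary: e rule: sigma_sets.induct)
    case (Basic a)
    then obtain i B where a: "a = {f. f i \<in> B}" and B[measurable]: "B \<in> sets M" by auto
    have "a = (\<lambda>f. f i) -` B \<inter> space noise" using a by auto
    also have "\<dots> \<in> sets noise" by (rule measurable_sets[OF _ B]) simp
    finally have "a \<in> sets noise" .
    moreover have "depends_on a {i}" by (auto simp: depends_on_def a)
    ultimately show ?case
      using Basic(2) by (intro exI[of _ a] exI[of _ "{i}"]) auto
  next
    case Empty
    then show ?case
      by (intro exI[of _ "{}"]) (auto simp: depends_on_def)
  next
    case (Compl a)
    then obtain C J where C: "C \<in> sets noise" "finite J" "depends_on C J"
      "measure noise ((a - C) \<union> (C - a)) < e" by blast
    have "(UNIV - a - (UNIV - C)) \<union> (UNIV - C - (UNIV - a)) = (a - C) \<union> (C - a)" by auto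
    moreover have "UNIV - C \<in> sets noise" using sets.compl_sets[OF C(1)] by simp
    moreover have "depends_on (UNIV - C) J" using C(3) by (auto simp: depends_on_def)
    ultimately show ?case using C by metis
  next
    case (Union a)
    have a[measurable]: "a i \<in> sets noise" for i
      using Union(1)[of i] unfolding sets_PiM_single by simp
    define U where "U n = (\<Union>i<n. a i)" for n
    have [measurable]: "U n \<in> sets noise" for n unfolding U_def by measurable
    have "(\<lambda>n. measure noise (U n)) \<longlonglongrightarrow> measure noise (\<Union>n. U n)"
      by (rule noise.finite_Lim_measure_incseq) (auto simp: U_def incseq_def intro: less_le_trans)
    moreover have "(\<Union>n. U n) = (\<Union>i. a i)" by (auto simp: U_def)
    ultimately have "\<forall>\<^sub>F n in sequentially. dist (measure noise (U n)) (measure noise (\<Union>i. a i)) < e / 2"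
      using Union.prems by (intro tendstoD) auto
    then obtain n where n: "dist (measure noise (U n)) (measure noise (\<Union>i. a i)) < e / 2"
      by (auto simp: eventually_sequentially)
    have sub: "U n \<subseteq> (\<Union>i. a i)" by (auto simp: U_def)
    then have n': "measure noise ((\<Union>i. a i) - U n) < e / 2"
      using n by (subst noise.finite_measure_Diff) (auto simp: dist_real_def abs_if split: if_splits)
    \<comment> \<open>Half of \<open>e\<close> is spent on the cut-off and half on the
      \<open>n\<close> approximations. Dividing by \<open>n + 1\<close> keeps the tolerance positive
      when \<open>n = 0\<close>.\<close>
    have "\<exists>C J. C \<in> sets noise \<and> finite J \<and> depends_on C J \<and>
      measure noise ((a i - C) \<union> (C - a i)) < e / 2 / (n + 1)" for i
      using Union.prems by (intro Union.IH) auto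
    then obtain C J where C[measurable]: "\<And>i. C i \<in> sets noise"
      and J: "\<And>i. finite (J i)" "\<And>i. depends_on (C i) (J i)"
      and Cm: "\<And>i. measure noise ((a i - C i) \<union> (C i - a i)) < e / 2 / (n + 1)"
      by metis
    define D where "D = (\<Union>i<n. C i)"
    have [measurable]: "D \<in> sets noise" unfolding D_def by measurable
    have "depends_on D (\<Union>i<n. J i)"
    proof (rule depends_onI)
      fix u v :: "int \<Rightarrow> 'a"
      assume *: "\<And>i. i \<in> (\<Union>i<n. J i) \<Longrightarrow> u i = v i" and "u \<in> D"
      then obtain i where i: "i < n" "u \<in> C i" by (auto simp: D_def)
      moreover have "\<forall>j\<in>J i. u j = v j" using * i by auto
      ultimately have "v \<in> C i" using J(2) unfolding depends_on_def by blast
      then show "v \<in> D" using i by (auto simp: D_def)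
    qed
    moreover have "measure noise (((\<Union>i. a i) - D) \<union> (D - (\<Union>i. a i))) < e"
    proof -
      have "measure noise (((\<Union>i. a i) - D) \<union> (D - (\<Union>i. a i)))
        \<le> measure noise (((\<Union>i. a i) - U n) \<union> (\<Union>i<n. (a i - C i) \<union> (C i - a i)))"
        by (intro noise.finite_measure_mono) (auto simp: D_def U_def)
      also have "\<dots> \<le> measure noise ((\<Union>i. a i) - U n) + measure noise (\<Union>i<n. (a i - C i) \<union> (C i - a i))"
        by (intro measure_Un_le) auto
      also have "measure noise (\<Union>i<n. (a i - C i) \<union> (C i - a i))
        \<le> (\<Sum>i<n. measure noise ((a i - C i) \<union> (C i - a i)))"
        by (intro measure_UNION_le) auto
      also have "\<dots> \<le> (\<Sum>i<n. e / 2 / (n + 1))"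
        by (intro sum_mono less_imp_le Cm)
      also have "\<dots> \<le> e / 2"
        using Union.prems by (simp add: field_simps)
      finally show ?thesis using n' by linarith
    qed
    ultimately show ?case
      using J(1) by (intro exI[of _ D] exI[of _ "\<Union>i<n. J i"]) auto
  qed
qed

text \<open>Mixing: a finitely determined \<open>C\<close> close to \<open>A\<close> and a far
  translate \<open>D\<close> of it are independent, and by invariance \<open>D\<close> is as close
  to \<open>A\<close> as \<open>C\<close> is. Thus the probability \<open>?p\<close> of
  \<open>A\<close> is arbitrarily close to its own square.\<close>

lemma translate_invariant_01:
  assumes A[measurable]: "A \<in> sets noise" and inv: "lshift -` A = A"
  shows "measure noise A = 0 \<or> measure noise A = 1"
proof -
  have tr: "(\<lambda>i. u (i + int n)) \<in> A \<longleftrightarrow> u \<in> A" for u n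
  proof (induction n arbitrary: u)
    case (Suc n)
    have "(\<lambda>i. u (i + int (Suc n))) = (\<lambda>i. lshift u (i + int n))"
      by (auto simp: lshift_def algebra_simps)
    then show ?case using Suc[of "lshift u"] inv by auto
  qed simp
  let ?p = "measure noise A"
  have bound: "\<bar>?p - ?p * ?p\<bar> \<le> 4 * e" if "e > 0" for e
  proof -
    obtain C J where C[measurable]: "C \<in> sets noise" and J: "finite J" "depends_on C J"
      and e: "measure noise ((A - C) \<union> (C - A)) < e"
      using finite_approx[OF A \<open>e > 0\<close>] by blast
    obtain m where m: "\<And>i. i \<in> J \<Longrightarrow> \<bar>i\<bar> \<le> m"
      using bdd_above_finite[OF finite_imageI[OF J(1), of abs]] by (auto simp: bdd_above_def)
    \<comment> \<open>Since \<open>J\<close> lies between \<open>- m\<close> and \<open>m\<close>, a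
      translation by more than \<open>2 * m\<close> moves it off itself.\<close>
    define n where "n = nat (2 * m + 1)"
    let ?f = "\<lambda>(u :: int \<Rightarrow> 'a) i. u (i + int n)"
    define D where "D = ?f -` C \<inter> space noise"
    have D[measurable]: "D \<in> sets noise" unfolding D_def by (rule measurable_sets[OF _ C]) measurable
    have dep: "depends_on D ((\<lambda>i. i + int n) ` J)"
      using J(2) unfolding depends_on_def D_def by auto
    have disj: "J \<inter> (\<lambda>i. i + int n) ` J = {}"
    proof -
      have "i + int n \<notin> J" if "i \<in> J" for i
        using m[OF that] m[of "i + int n"] unfolding n_def by auto
      then show ?thesis by auto
    qed
    have CD: "measure noise (C \<inter> D) = measure noise C * measure noise D"
      using measure_PiM_Int_indep[OF _ C D J(2) dep disj] prob_space_axioms by blast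
    have Dm: "measure noise D = measure noise C"
      unfolding D_def by (rule prob_translate[OF C])
    have "(A - D) \<union> (D - A) = ?f -` ((A - C) \<union> (C - A)) \<inter> space noise"
      using tr[of _ n] by (auto simp: D_def)
    then have eD: "measure noise ((A - D) \<union> (D - A)) < e"
      using e prob_translate[of "(A - C) \<union> (C - A)" "int n"] by simp
    have diff: "\<bar>measure noise X - measure noise Y\<bar> \<le> measure noise ((X - Y) \<union> (Y - X))"
      if [measurable]: "X \<in> sets noise" "Y \<in> sets noise" for X Y
    proof -
      have "measure noise X \<le> measure noise (Y \<union> ((X - Y) \<union> (Y - X)))"
        by (intro noise.finite_measure_mono) auto
      also have "\<dots> \<le> measure noise Y + measure noise ((X - Y) \<union> (Y - X))"
        by (intro measure_Un_le) auto
      finally have 1: "measure noise X \<le> \<dots>" .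
      have "measure noise Y \<le> measure noise (X \<union> ((X - Y) \<union> (Y - X)))"
        by (intro noise.finite_measure_mono) auto
      also have "\<dots> \<le> measure noise X + measure noise ((X - Y) \<union> (Y - X))"
        by (intro measure_Un_le) auto
      finally show ?thesis using 1 by linarith
    qed
    have 1: "\<bar>?p - measure noise C\<bar> < e" using diff[OF A C] e by linarith
    have "\<bar>?p - measure noise (C \<inter> D)\<bar>
      \<le> measure noise ((A - C \<inter> D) \<union> (C \<inter> D - A))"
      by (intro diff) auto
    also have "\<dots> \<le> measure noise (((A - C) \<union> (C - A)) \<union> ((A - D) \<union> (D - A)))"
      by (intro noise.finite_measure_mono) auto
    also have "\<dots> \<le> measure noise ((A - C) \<union> (C - A)) + measure noise ((A - D) \<union> (D - A))"
      by (intro measure_Un_le) auto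
    finally have 2: "\<bar>?p - measure noise C * measure noise C\<bar> < 2 * e"
      using e eD CD Dm by simp
    have "\<bar>measure noise C * measure noise C - ?p * ?p\<bar>
      = \<bar>?p - measure noise C\<bar> * \<bar>measure noise C + ?p\<bar>"
      unfolding abs_mult[symmetric] by (subst abs_minus_commute) (simp add: algebra_simps)
    also have "\<dots> \<le> e * 2"
    proof (intro mult_mono)
      show "\<bar>measure noise C + ?p\<bar> \<le> 2"
        using add_mono[OF noise.prob_le_1[of C] noise.prob_le_1[of A]] measure_nonneg[of noise]
        by (subst abs_of_nonneg) (simp_all only: add_nonneg_nonneg one_add_one)
    qed (use 1 that in auto)
    finally show ?thesis using 2 by linarith
  qed
  have "\<bar>?p - ?p * ?p\<bar> \<le> 0"
    by (rule field_le_epsilon) (use bound[of "_ / 4"] in force)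
  then have "?p * (1 - ?p) = 0" by (simp add: algebra_simps)
  then show ?thesis by simp
qed

text \<open>The event that infinitely many translates hit \<open>B\<close> is invariant, and by
  continuity from above it is at least as likely as \<open>B\<close>; the zero-one law makes it
  almost sure.\<close>

lemma AE_infinitely_often:
  assumes [measurable]: "B \<in> sets noise" and pos: "measure noise B > 0"
  shows "AE u in noise. \<forall>m. \<exists>n::nat\<ge>m. (\<lambda>i. u (i + int n)) \<in> B"
proof -
  define T where "T n = (\<lambda>u i. u (i + int n)) -` B \<inter> space noise" for n
  have [measurable]: "T n \<in> sets noise" for n unfolding T_def by measurable
  define V where "V m = (\<Union>n\<in>{m..}. T n)" for m
  have [measurable]: "V m \<in> sets noise" for m unfolding V_def by measurable
  have V: "measure noise B \<le> measure noise (V m)" for m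
  proof -
    have "measure noise B = measure noise (T m)" unfolding T_def by (rule prob_translate[symmetric]) simp
    also have "\<dots> \<le> measure noise (V m)"
      by (intro noise.finite_measure_mono) (auto simp: V_def)
    finally show ?thesis .
  qed
  have "(\<lambda>m. measure noise (V m)) \<longlonglongrightarrow> measure noise (\<Inter>m. V m)"
    by (rule noise.finite_Lim_measure_decseq) (auto simp: V_def decseq_def intro: order_trans)
  then have "measure noise B \<le> measure noise (\<Inter>m. V m)"
    using V by (intro LIMSEQ_le_const) auto
  moreover have "lshift -` (\<Inter>m. V m) = (\<Inter>m. V m)"
  proof -
    have eq: "u \<in> (\<Inter>m. V m) \<longleftrightarrow> (\<forall>m. \<exists>n\<ge>m. (\<lambda>i. u (i + int n)) \<in> B)" for u
      by (auto simp: V_def T_def)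
    have sh: "(\<lambda>i. lshift u (i + int n)) = (\<lambda>i. u (i + int (Suc n)))" for u :: "int \<Rightarrow> 'a" and n
      by (auto simp: lshift_def algebra_simps)
    have "(\<forall>m. \<exists>n\<ge>m. (\<lambda>i. u (i + int (Suc n))) \<in> B) \<longleftrightarrow> (\<forall>m. \<exists>n\<ge>m. (\<lambda>i. u (i + int n)) \<in> B)" for u
    proof
      assume L: "\<forall>m. \<exists>n\<ge>m. (\<lambda>i. u (i + int (Suc n))) \<in> B"
      show "\<forall>m. \<exists>n\<ge>m. (\<lambda>i. u (i + int n)) \<in> B"
        using L le_SucI by blast
    next
      assume R: "\<forall>m. \<exists>n\<ge>m. (\<lambda>i. u (i + int n)) \<in> B"
      show "\<forall>m. \<exists>n\<ge>m. (\<lambda>i. u (i + int (Suc n))) \<in> B"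
        using R by (metis Suc_le_D Suc_le_mono)
    qed
    then show ?thesis
      unfolding vimage_def eq sh set_eq_iff mem_Collect_eq by blast
  qed
  ultimately have "measure noise (\<Inter>m. V m) = 1"
    using translate_invariant_01[of "\<Inter>m. V m"] pos by auto
  then have "AE u in noise. u \<in> (\<Inter>m. V m)"
    by (subst (asm) noise.prob_eq_1) auto
  then show ?thesis
    by eventually_elim (auto simp: V_def T_def)
qed

end

subsection \<open>The age process\<close>

abbreviation M3 :: "nat measure" where
  "M3 \<equiv> measure_pmf (pmf_of_set {..<3})"

interpretation U: iid_noise M3
  by unfold_locales simp

definition Om :: "(int \<Rightarrow> nat) measure" where
  "Om = PiM UNIV (\<lambda>_. M3)"

interpretation O: prob_space Om
  unfolding Om_def by (rule U.noise.prob_space_axioms)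

lemmas space_Om [simp] = U.space_noise[folded Om_def]
  and measure_Om_cylinder = U.measure_noise_cylinder[folded Om_def]
  and measure_Om_translate = U.prob_translate[folded Om_def]
  and Om_invariant_01 = U.translate_invariant_01[folded Om_def]
  and AE_Om_infinitely_often = U.AE_infinitely_often[folded Om_def]
  and measure_Om_Int_indep =
    measure_PiM_Int_indep[where M = "\<lambda>_ :: int. M3", OF prob_space_measure_pmf, folded Om_def]

lemma measure_M3: "measure M3 A = card (A \<inter> {..<3}) / 3"
  by (subst measure_pmf_of_set) (auto simp: Int_commute lessThan_empty_iff)

text \<open>The entry \<open>v 0\<close> is never read: position 0 counts as a renewal, and in
  \<open>age\<close> it is the position of the last forced one whenever there is one.\<close>

fun age_from :: "nat set \<Rightarrow> (nat \<Rightarrow> nat) \<Rightarrow> nat \<Rightarrow> nat" where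
  "age_from S v 0 = 0"
| "age_from S v (Suc j) =
    (if v (Suc j) = 0 \<or> v (Suc j) = 1 \<and> age_from S v j \<in> S then 0 else Suc (age_from S v j))"

text \<open>The age is the time elapsed since the last renewal. The noise value 0 forces a renewal, 2
  forbids one, and 1 causes a renewal iff the current age lies in the set. Hence the age is
  computed by running the recursion forward from the last 0, which makes the renewal process a
  shift-equivariant factor of the noise. (If there is no such 0, the result of the LEAST is
  arbitrary, but it still commutes with shifts.)\<close>

definition last_zero :: "(int \<Rightarrow> nat) \<Rightarrow> int \<Rightarrow> nat" where
  "last_zero u n = (LEAST d. u (n - int d) = 0)"

definition age :: "nat set \<Rightarrow> (int \<Rightarrow> nat) \<Rightarrow> int \<Rightarrow> nat" where
  "age S u n = age_from S (\<lambda>j. u (n - int (last_zero u n) + int j)) (last_zero u n)"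

definition renewal :: "nat set \<Rightarrow> (int \<Rightarrow> nat) \<Rightarrow> int \<Rightarrow> bool" where
  "renewal S u n \<longleftrightarrow> age S u n = 0"

text \<open>The almost sure event on which \<open>last_zero\<close> is meaningful, so that the ages
  obey their recursion.\<close>

definition good :: "(int \<Rightarrow> nat) \<Rightarrow> bool" where
  "good u \<longleftrightarrow> (\<forall>n. \<exists>d::nat. u (n - int d) = 0)"

lemma age_from_cong:
  "(\<And>i. i \<le> j \<Longrightarrow> v i = w i) \<Longrightarrow> age_from S v j = age_from S w j"
  by (induction j) auto

text \<open>Unless the noise at \<open>n + 1\<close> is 0, the last zero seen from
  \<open>n + 1\<close> is the one seen from \<open>n\<close>, and both ages run the recursion from
  the same starting point.\<close>

lemma age_step:
  assumes "good u"
  shows "age S u (n + 1) =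
    (if u (n + 1) = 0 \<or> u (n + 1) = 1 \<and> age S u n \<in> S then 0 else Suc (age S u n))"
proof (cases "u (n + 1) = 0")
  case True
  then have "last_zero u (n + 1) = 0"
    unfolding last_zero_def by (intro Least_eq_0) simp
  then show ?thesis using True by (simp add: age_def)
next
  case False
  obtain d where "u (n + 1 - int d) = 0" using assms unfolding good_def by blast
  then have "last_zero u (n + 1) = Suc (LEAST d. u (n + 1 - int (Suc d)) = 0)"
    unfolding last_zero_def by (rule Least_Suc) (use False in simp)
  then have "last_zero u (n + 1) = Suc (last_zero u n)"
    by (simp add: last_zero_def)
  then show ?thesis using False by (simp add: age_def add.commute)
qed

lemma age_translate: "age S (\<lambda>i. u (i + c)) n = age S u (n + c)"
proof -
  have "last_zero (\<lambda>i. u (i + c)) n = last_zero u (n + c)"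
    by (simp add: last_zero_def algebra_simps)
  then show ?thesis by (simp add: age_def algebra_simps)
qed

lemma age_cong:
  assumes "\<And>i. i \<le> n \<Longrightarrow> u i = v i"
  shows "age S u n = age S v n"
proof -
  have "last_zero u n = last_zero v n"
    using assms by (simp add: last_zero_def)
  then show ?thesis
    unfolding age_def using assms by (auto intro!: age_from_cong)
qed

text \<open>This makes the age a function of the renewal path alone, so that it can be read off the
  observed series instead of the noise.\<close>

lemma age_eq_iff:
  assumes "good u"
  shows "age S u n = d \<longleftrightarrow> renewal S u (n - int d) \<and> (\<forall>e<d. \<not> renewal S u (n - int e))"
proof (induction d arbitrary: n)
  case 0
  then show ?case by (simp add: renewal_def)
next
  case (Suc d)
  have "age S u n = Suc d \<longleftrightarrow> \<not> renewal S u n \<and> age S u (n - 1) = d"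
    using age_step[OF assms, of S "n - 1"] by (auto simp: renewal_def)
  also have "\<dots> \<longleftrightarrow> renewal S u (n - int (Suc d)) \<and>
    \<not> renewal S u n \<and> (\<forall>e<d. \<not> renewal S u (n - int (Suc e)))"
    unfolding Suc by (auto simp: algebra_simps)
  also have "(\<not> renewal S u n \<and> (\<forall>e<d. \<not> renewal S u (n - int (Suc e))))
    \<longleftrightarrow> (\<forall>e<Suc d. \<not> renewal S u (n - int e))"
    by (auto simp: All_less_Suc2)
  finally show ?case .
qed

lemma age_eq_Least:
  assumes "good u"
  shows "age S u n = (LEAST d. renewal S u (n - int d))"
  using age_eq_iff[OF assms, of S n "age S u n"]
  by (intro Least_equality[symmetric]) (auto simp: not_less[symmetric])

text \<open>The zero at time 0 forces a renewal there. In particular a level \<open>L\<close> cannot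
  be reached before time \<open>L\<close>.\<close>

lemma age_le:
  assumes "good u" "u 0 = 0"
  shows "age S u (int t) \<le> t"
proof (induction t)
  case 0
  have "age S u 0 = 0" using age_step[OF assms(1), of S "-1"] assms(2) by simp
  then show ?case by simp
next
  case (Suc t)
  then show ?case using age_step[OF assms(1), of S "int t"] by (auto simp: add.commute)
qed

text \<open>The age is 0 at time 0 and grows by at most one per step, so it skips no level on its
  way up.\<close>

lemma age_attains:
  assumes "good u" "u 0 = 0" "L \<le> age S u (int t)"
  shows "\<exists>s\<le>t. age S u (int s) = L"
  using assms(3)
proof (induction t)
  case 0
  then show ?case using age_le[OF assms(1,2), of S 0] by auto
next
  case (Suc t)
  show ?case
  proof (cases "age S u (int (Suc t)) = L")
    case True
    then show ?thesis by blast
  next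
    case False
    have "age S u (int (Suc t)) \<le> Suc (age S u (int t))"
      using age_step[OF assms(1), of S "int t"] by (simp add: add.commute[of 1])
    then have "L \<le> age S u (int t)" using False Suc.prems by linarith
    then obtain s where "s \<le> t" "age S u (int s) = L" using Suc.IH by blast
    then show ?thesis using le_SucI by blast
  qed
qed

text \<open>Before the first visit to \<open>L\<close> all ages are below \<open>L\<close>, so only
  the part of the set below \<open>L\<close> is consulted. Time \<open>t\<close> itself is included
  because the age there is computed from the age one step earlier.\<close>

lemma age_agree:
  assumes "good u" "u 0 = 0" and S: "S \<inter> {..<L} = S' \<inter> {..<L}"
    and "\<And>s. s < t \<Longrightarrow> age S u (int s) \<noteq> L" and "s \<le> t"
  shows "age S' u (int s) = age S u (int s)"
  using \<open>s \<le> t\<close>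
proof (induction s)
  case 0
  then show ?case using age_le[OF assms(1,2), of _ 0] by simp
next
  case (Suc s)
  have "\<not> L \<le> age S u (int s)"
  proof
    assume "L \<le> age S u (int s)"
    then obtain r where "r \<le> s" "age S u (int r) = L"
      using age_attains[OF assms(1,2)] by blast
    then show False using assms(4)[of r] Suc.prems by simp
  qed
  moreover have "age S u (int s) \<in> S \<inter> {..<L} \<longleftrightarrow> age S u (int s) \<in> S' \<inter> {..<L}"
    by (simp only: S)
  ultimately have S': "age S u (int s) \<in> S' \<longleftrightarrow> age S u (int s) \<in> S"
    by (simp add: not_le)
  have s: "age S' u (int s) = age S u (int s)"
    using Suc by simp
  have "age S' u (int s + 1) = age S u (int s + 1)"
    unfolding age_step[OF assms(1)] s S' ..
  then show ?case
    by (simp add: add.commute[of 1])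
qed

section \<open>Measurability of ages and renewals, and almost sure goodness of the noise\<close>

lemma measurable_coord [measurable]: "(\<lambda>u. u i) \<in> measurable Om (count_space UNIV)"
proof -
  have "(\<lambda>u. u i) \<in> measurable Om M3" unfolding Om_def by measurable
  then show ?thesis by simp
qed

lemma measurable_count_space_binop:
  fixes f :: "'a \<Rightarrow> 'b :: countable" and F :: "'b \<Rightarrow> 'c \<Rightarrow> 'd"
  assumes f: "f \<in> measurable N (count_space UNIV)" and g: "g \<in> measurable N (count_space UNIV)"
  shows "(\<lambda>x. F (f x) (g x)) \<in> measurable N (count_space UNIV)"
proof -
  have "(\<lambda>x. F i (g x)) \<in> measurable N (count_space UNIV)" for i
    using measurable_compose[OF g, of "F i" "count_space UNIV"] by simp
  then show ?thesis
    by (rule measurable_compose_countable[of "\<lambda>i x. F i (g x)", OF _ f])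
qed

lemma measurable_age_from:
  "(\<lambda>u. age_from S (\<lambda>j. u (c + int j)) k) \<in> measurable Om (count_space UNIV)"
proof (induction k)
  case (Suc k)
  show ?case
    unfolding age_from.simps
    by (rule measurable_count_space_binop[OF measurable_coord Suc,
        of "\<lambda>a b. if a = 0 \<or> a = 1 \<and> b \<in> S then 0 else Suc b"])
qed simp

lemma measurable_age [measurable]: "(\<lambda>u. age S u n) \<in> measurable Om (count_space UNIV)"
proof -
  have last: "(\<lambda>u. last_zero u n) \<in> measurable Om (count_space UNIV)"
    unfolding last_zero_def by measurable
  define f where "f d u = age_from S (\<lambda>j. u (n - int d + int j)) d" for d and u :: "int \<Rightarrow> nat"
  have f: "f d \<in> measurable Om (count_space UNIV)" for d
    unfolding f_def by (rule measurable_age_from)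
  have "(\<lambda>u. f (last_zero u n) u) \<in> measurable Om (count_space UNIV)"
    by (rule measurable_compose_countable[of f, OF f last])
  moreover have "(\<lambda>u. f (last_zero u n) u) = (\<lambda>u. age S u n)"
    by (simp only: f_def age_def)
  ultimately show ?thesis by (simp only:)
qed

lemma measurable_renewal_coord [measurable]:
  "(\<lambda>u. renewal S u n) \<in> measurable Om (count_space UNIV)"
  unfolding renewal_def by measurable

lemma measurable_renewal [measurable]: "renewal S \<in> measurable Om BS"
  unfolding BS_def by (rule measurable_PiM_single') (auto simp: space_PiM)

lemma sets_cylinder:
  assumes "finite J" shows "{u. \<forall>i\<in>J. u i \<in> X i} \<in> sets Om"
proof -
  have "{u \<in> space Om. \<forall>i\<in>J. u i \<in> X i} \<in> sets Om"
    using assms by (intro sets.sets_Collect_finite_All) measurable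
  then show ?thesis by simp
qed

text \<open>For each \<open>n\<close>, the last \<open>m\<close> noise values up to \<open>n\<close>
  avoid 0 with probability \<open>(2 / 3) ^ m\<close>, which tends to 0.\<close>

lemma AE_good: "AE u in Om. good u"
proof -
  have "AE u in Om. \<exists>d::nat. u (n - int d) = 0" for n
  proof -
    define N where "N m = {u :: int \<Rightarrow> nat. \<forall>i\<in>(\<lambda>d. n - int d) ` {..<m}. u i \<in> - {0}}" for m
    have N: "N m \<in> sets Om" for m
      unfolding N_def by (rule sets_cylinder) simp
    have "measure Om (N m) = (2 / 3) ^ m" for m
    proof -
      have "- {0} \<inter> {..<3} = {1, 2 :: nat}" by auto
      then have "measure M3 (- {0}) = 2 / 3" by (simp add: measure_M3)
      then have "measure Om (N m) = (\<Prod>i\<in>(\<lambda>d. n - int d) ` {..<m}. 2 / 3)"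
        unfolding N_def
        by (subst measure_Om_cylinder) (simp_all only: finite_imageI finite_lessThan sets_measure_pmf UNIV_I)
      also have "\<dots> = (2 / 3) ^ m"
        by (subst prod.reindex) (auto simp: inj_on_def)
      finally show ?thesis .
    qed
    moreover have "(\<lambda>m. measure Om (N m)) \<longlonglongrightarrow> measure Om (\<Inter>m. N m)"
    proof (rule O.finite_Lim_measure_decseq)
      show "range N \<subseteq> sets Om" using N by blast
      show "decseq N" by (rule decseq_SucI) (auto simp: N_def)
    qed
    ultimately have "(\<lambda>m. (2 / 3) ^ m) \<longlonglongrightarrow> measure Om (\<Inter>m. N m)"
      by simp
    then have "measure Om (\<Inter>m. N m) = 0"
      by (rule LIMSEQ_unique) (rule LIMSEQ_realpow_zero, simp_all)
    then have "emeasure Om (\<Inter>m. N m) = 0"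
      unfolding O.emeasure_eq_measure by simp
    moreover have "(\<Inter>m. N m) \<in> sets Om"
      using N by blast
    ultimately have "AE u in Om. u \<notin> (\<Inter>m. N m)"
      by (intro AE_not_in null_setsI)
    then show ?thesis
      by eventually_elim (auto simp: N_def)
  qed
  then show ?thesis unfolding good_def AE_all_countable by blast
qed

subsection \<open>Laws of the renewal processes\<close>

definition law :: "nat set \<Rightarrow> (int \<Rightarrow> bool) measure" where
  "law S = distr Om BS (renewal S)"

text \<open>Each noise value has probability 1/3: the value 0 always renews, and the value 1 adds a
  second third exactly on \<open>S\<close>.\<close>

definition hazard :: "nat set \<Rightarrow> nat \<Rightarrow> real" where
  "hazard S a = (if a \<in> S then 2 / 3 else 1 / 3)"

lemma space_BS [simp]: "space BS = UNIV" and space_BS1 [simp]: "space BS1 = UNIV"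
  by (simp_all add: BS_def BS1_def space_PiM)

lemma sets_law [simp, measurable_cong]: "sets (law S) = sets BS"
  by (simp add: law_def)

lemma space_law [simp]: "space (law S) = UNIV"
  by (simp add: law_def)

lemma measurable_BS_coord [measurable]: "(\<lambda>x. x i) \<in> measurable BS (count_space UNIV)"
  unfolding BS_def by measurable

lemma measurable_BS1_coord [measurable]: "(\<lambda>x. x i) \<in> measurable BS1 (count_space UNIV)"
  unfolding BS1_def by measurable

lemma measurable_past [measurable]: "past \<in> measurable BS BS1"
  unfolding BS1_def past_def by (rule measurable_PiM_single') (auto simp: space_PiM)

lemma measurable_shift [measurable]: "shift \<in> measurable BS BS"
  unfolding shift_def by (subst (2) BS_def, rule measurable_PiM_single') (auto simp: space_PiM)

lemma measure_law:
  "A \<in> sets BS \<Longrightarrow> measure (law S) A = measure Om {u. renewal S u \<in> A}"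
  unfolding law_def by (subst measure_distr) (auto simp: vimage_def)

lemma AE_law:
  assumes "AE x in law S. Q x" shows "AE u in Om. Q (renewal S u)"
  using assms unfolding law_def by (rule AE_distrD[OF measurable_renewal])

lemma prob_space_law: "prob_space (law S)"
  unfolding law_def by (rule O.prob_space_distr) measurable

text \<open>This equivariance carries stationarity and ergodicity from the noise to the law of the
  renewals.\<close>

lemma renewal_lshift: "renewal S (lshift u) = shift (renewal S u)"
  unfolding lshift_def shift_def renewal_def age_translate ..

lemma binary_ts_law: "binary_ts (law S)"
  by (simp add: binary_ts_def prob_space_law)

lemma stationary_law: "stationary (law S)"
  unfolding stationary_def
proof (intro conjI ballI binary_ts_law)
  fix A assume "A \<in> sets (law S)"
  then have [measurable]: "A \<in> sets BS" by simp
  have "shift -` A \<inter> space BS \<in> sets BS" by measurable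
  then have "measure (law S) (shift -` A) = measure Om {u. shift (renewal S u) \<in> A}"
    by (subst measure_law) auto
  also have "\<dots> = measure Om ((\<lambda>u i. u (i + 1)) -` {u. renewal S u \<in> A} \<inter> space Om)"
    unfolding renewal_lshift[symmetric] lshift_def by (simp add: vimage_def)
  also have "\<dots> = measure Om {u. renewal S u \<in> A}"
  proof (rule measure_Om_translate)
    have "renewal S -` A \<inter> space Om \<in> sets Om" by measurable
    then show "{u. renewal S u \<in> A} \<in> sets Om" by (simp add: vimage_def)
  qed
  finally show "measure (law S) (shift -` A) = measure (law S) A"
    by (simp add: measure_law)
qed

lemma ergodic_law: "ergodic (law S)"
  unfolding ergodic_def
proof (intro ballI impI)
  fix A assume "A \<in> sets (law S)" and inv: "shift -` A = A"
  then have A[measurable]: "A \<in> sets BS" by simp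
  have "renewal S -` A \<inter> space Om \<in> sets Om" by measurable
  then have "{u. renewal S u \<in> A} \<in> sets Om" by (simp add: vimage_def)
  moreover have "lshift -` {u. renewal S u \<in> A} = {u. renewal S u \<in> A}"
    using inv by (auto simp: renewal_lshift)
  ultimately show "measure (law S) A = 0 \<or> measure (law S) A = 1"
    unfolding measure_law[OF A] by (rule Om_invariant_01)
qed

lemma Collect_sets_Om [measurable (raw)]: "Measurable.pred Om Q \<Longrightarrow> {u. Q u} \<in> sets Om"
  by (drule predE) simp

text \<open>A renewal at \<open>n + 1\<close> needs the noise value 0, or the value 1 with the
  current age in \<open>S\<close>. The noise at \<open>n + 1\<close> is independent of everything
  determined up to \<open>n\<close>, the age included.\<close>

lemma prob_next:
  assumes A[measurable]: "A \<in> sets Om" and dep: "depends_on A {..n}"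
  shows "measure Om {u \<in> A. renewal S u (n + 1)}
    = measure Om A / 3 + measure Om {u \<in> A. age S u n \<in> S} / 3"
proof -
  define B where "B = {u \<in> A. age S u n \<in> S}"
  define E where "E c = {u :: int \<Rightarrow> nat. u (n + 1) = c}" for c
  have [measurable]: "E c \<in> sets Om" "B \<in> sets Om" for c
    unfolding E_def B_def by measurable
  have depB: "depends_on B {..n}"
  proof (rule depends_onI)
    fix u v :: "int \<Rightarrow> nat" assume *: "\<And>i. i \<in> {..n} \<Longrightarrow> u i = v i" and u: "u \<in> B"
    then have "age S u n = age S v n" by (intro age_cong) auto
    moreover have "u \<in> A \<longleftrightarrow> v \<in> A" using dep * unfolding depends_on_def by blast
    ultimately show "v \<in> B" using u by (auto simp: B_def)
  qed
  have E: "measure Om (E c) = 1 / 3" if "c < 3" for c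
    using measure_Om_cylinder[of "{n + 1}" "\<lambda>_. {c}"] that
    by (simp add: E_def measure_M3)
  have ind: "measure Om (X \<inter> E c) = measure Om X / 3"
    if "X \<in> sets Om" "depends_on X {..n}" "c < 3" for X c
  proof -
    have "depends_on (E c) {n + 1}" by (auto simp: depends_on_def E_def)
    then show ?thesis
      using measure_Om_Int_indep[OF that(1) _ that(2), of "E c" "{n + 1}"] E[OF that(3)]
      by simp
  qed
  have "measure Om {u \<in> A. renewal S u (n + 1)} = measure Om ((A \<inter> E 0) \<union> (B \<inter> E 1))"
  proof (rule measure_eq_AE)
    show "AE u in Om. u \<in> {u \<in> A. renewal S u (n + 1)} \<longleftrightarrow> u \<in> (A \<inter> E 0) \<union> (B \<inter> E 1)"
      using AE_good by eventually_elim (auto simp: renewal_def age_step B_def E_def split: if_splits)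
  qed measurable
  also have "\<dots> = measure Om (A \<inter> E 0) + measure Om (B \<inter> E 1)"
    by (rule O.finite_measure_Union) (auto simp: E_def)
  finally show ?thesis
    using ind[OF A dep, of 0] ind[OF _ depB, of 1] by (simp add: B_def)
qed

text \<open>The number \<open>a\<close> only has to agree with the current age about membership in
  \<open>S\<close>; this allows the age to be replaced by a truncated one in the finite-order
  case.\<close>

lemma prob_next_hazard:
  assumes A[measurable]: "A \<in> sets Om" and "depends_on A {..n}"
    and *: "\<And>u. good u \<Longrightarrow> u \<in> A \<Longrightarrow> age S u n \<in> S \<longleftrightarrow> a \<in> S"
  shows "measure Om {u \<in> A. renewal S u (n + 1)} = hazard S a * measure Om A"
proof -
  have "measure Om {u \<in> A. age S u n \<in> S} = measure Om (if a \<in> S then A else {})"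
  proof (rule measure_eq_AE)
    show "AE u in Om. u \<in> {u \<in> A. age S u n \<in> S} \<longleftrightarrow> u \<in> (if a \<in> S then A else {})"
      using AE_good by eventually_elim (use * in auto)
  qed auto
  then show ?thesis
    by (simp add: prob_next[OF assms(1,2)] hazard_def)
qed

section \<open>Finite prefixes: the Markov property and the elementary conditional
  probability\<close>

lemma renewal_cong: "(\<And>i. i \<le> n \<Longrightarrow> u i = v i) \<Longrightarrow> renewal S u n = renewal S v n"
  using age_cong[of n u v S] by (simp add: renewal_def)

lemma depends_on_prefix:
  "depends_on {u. \<forall>i<n. renewal S u (int i) = w i} {..int n - 1}"
proof (rule depends_onI)
  fix u v :: "int \<Rightarrow> nat" assume "\<And>i. i \<in> {..int n - 1} \<Longrightarrow> u i = v i"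
  then have "renewal S u (int i) = renewal S v (int i)" if "i < n" for i
    using that by (intro renewal_cong) auto
  then show "u \<in> {u. \<forall>i<n. renewal S u (int i) = w i} \<Longrightarrow>
    v \<in> {u. \<forall>i<n. renewal S u (int i) = w i}" by auto
qed

lemma sets_BS_prefix: "{x. \<forall>i<n. x (int i) = w i} \<in> sets BS"
  "{x. (\<forall>i<n. x (int i) = w i) \<and> x (int n)} \<in> sets BS"
proof -
  have "{x \<in> space BS. \<forall>i<n. x (int i) = w i} \<in> sets BS"
    "{x \<in> space BS. (\<forall>i<n. x (int i) = w i) \<and> x (int n)} \<in> sets BS"
    by measurable
  then show "{x. \<forall>i<n. x (int i) = w i} \<in> sets BS"
    "{x. (\<forall>i<n. x (int i) = w i) \<and> x (int n)} \<in> sets BS" by simp_all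
qed

lemma prefix_next_law:
  assumes "\<And>u. good u \<Longrightarrow> (\<And>i. i < n \<Longrightarrow> renewal S u (int i) = w i)
    \<Longrightarrow> age S u (int n - 1) \<in> S \<longleftrightarrow> a \<in> S"
  shows "measure (law S) {x. (\<forall>i<n. x (int i) = w i) \<and> x (int n)}
    = hazard S a * measure (law S) {x. \<forall>i<n. x (int i) = w i}"
proof -
  let ?A = "{u. \<forall>i<n. renewal S u (int i) = w i}"
  have "measure Om {u \<in> ?A. renewal S u (int n - 1 + 1)} = hazard S a * measure Om ?A"
    using assms by (intro prob_next_hazard depends_on_prefix) (measurable, auto)
  then show ?thesis
    by (simp add: measure_law sets_BS_prefix)
qed

text \<open>All ages from \<open>K\<close> on lie outside \<open>S\<close> and share one hazard, so
  the age capped at \<open>K\<close> suffices, and it is visible in the last \<open>K\<close>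
  symbols.\<close>

lemma markov_law:
  assumes "finite S"
  shows "markov_finite_order (law S)"
proof -
  obtain K where K: "S \<subseteq> {..<K}"
    using finite_nat_iff_bounded assms by blast
  \<comment> \<open>Entry \<open>K - 1 - d\<close> of the list is the symbol \<open>d\<close> steps
    before the latest one. The alternative \<open>d = K\<close> makes the search return
    \<open>K\<close> when the window contains no renewal.\<close>
  define p where "p l = hazard S (LEAST d. d = K \<or> l ! (K - 1 - d))" for l :: "bool list"
  have "measure (law S) {x. (\<forall>i<n. x (int i) = w i) \<and> x (int n)}
    = p (map w [n - K..<n]) * measure (law S) {x. \<forall>i<n. x (int i) = w i}"
    if n: "n \<ge> K" for n w
    unfolding p_def
  proof (rule prefix_next_law)
    fix u assume u: "good u" and pre: "\<And>i. i < n \<Longrightarrow> renewal S u (int i) = w i"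
    let ?l = "map w [n - K..<n]" and ?a = "age S u (int n - 1)"
    let ?P = "\<lambda>d. d = K \<or> ?l ! (K - 1 - d)"
    have l: "?l ! (K - 1 - d) = renewal S u (int n - 1 - int d)" if "d < K" for d
    proof -
      have "?l ! (K - 1 - d) = w (n - 1 - d)" using that n by simp
      also have "\<dots> = renewal S u (int (n - 1 - d))" using that n by (intro pre[symmetric]) auto
      also have "int (n - 1 - d) = int n - 1 - int d" using that n by auto
      finally show ?thesis .
    qed
    have a: "renewal S u (int n - 1 - int ?a)" "\<And>e. e < ?a \<Longrightarrow> \<not> renewal S u (int n - 1 - int e)"
      using age_eq_iff[OF u, of S "int n - 1" ?a] by auto
    have "(LEAST d. ?P d) = min ?a K"
    proof (rule Least_equality)
      show "?P (min ?a K)"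
        using a(1) l[of ?a] by (cases "?a < K") auto
      fix y assume "?P y"
      show "min ?a K \<le> y"
      proof (rule ccontr)
        assume "\<not> min ?a K \<le> y"
        then have y: "y < ?a" "y < K" by simp_all
        then have "?l ! (K - 1 - y)" using \<open>?P y\<close> by (metis less_irrefl)
        then show False unfolding l[OF y(2)] using a(2)[OF y(1)] by (rule notE[rotated])
      qed
    qed
    then show "?a \<in> S \<longleftrightarrow> (LEAST d. ?P d) \<in> S" using K by (auto simp: min_def)
  qed
  then show ?thesis unfolding markov_finite_order_def by blast
qed

text \<open>Noise values 0 and 2 force and forbid renewals whatever the age, so finitely many of
  them dictate any prefix. Hence the denominator in \<open>pcond\<close> is nonzero.\<close>

lemma prefix_pos: "measure (law S) {x. \<forall>i<n. x (int i) = w i} > 0"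
proof -
  define X where "X i = {if w (nat i) then 0 else 2 :: nat}" for i
  have "0 < (\<Prod>i\<in>int ` {..<n}. measure M3 (X i))"
    by (intro prod_pos) (auto simp: X_def measure_M3)
  also have "\<dots> = measure Om {u. \<forall>i\<in>int ` {..<n}. u i \<in> X i}"
    by (intro measure_Om_cylinder[symmetric]) auto
  also have "\<dots> \<le> measure Om {u. \<forall>i<n. renewal S u (int i) = w i}"
  proof (rule O.finite_measure_mono_AE)
    show "AE u in Om. u \<in> {u. \<forall>i\<in>int ` {..<n}. u i \<in> X i} \<longrightarrow>
      u \<in> {u. \<forall>i<n. renewal S u (int i) = w i}"
      using AE_good
    proof eventually_elim
      fix u assume u: "good u"
      show "u \<in> {u. \<forall>i\<in>int ` {..<n}. u i \<in> X i} \<longrightarrow>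
        u \<in> {u. \<forall>i<n. renewal S u (int i) = w i}"
      proof (intro impI CollectI allI)
        fix i assume "u \<in> {u. \<forall>i\<in>int ` {..<n}. u i \<in> X i}" "i < n"
        then have "u (int i) = (if w i then 0 else 2)" by (auto simp: X_def)
        then show "renewal S u (int i) = w i"
          using age_step[OF u, of S "int i - 1"] by (auto simp: renewal_def)
      qed
    qed
  qed measurable
  finally show ?thesis by (simp add: measure_law sets_BS_prefix)
qed

text \<open>With a renewal at time 0 the latest renewal before or at \<open>k\<close> lies inside
  the observed window, so all good noise producing the same prefix has the same age at
  \<open>k\<close>.\<close>

lemma pcond_law:
  assumes u: "good u" and "renewal S u 0"
  shows "pcond (law S) k (path (renewal S u)) = hazard S (age S u (int k))"
proof -
  let ?w = "path (renewal S u)" and ?a = "age S u (int k)"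
  have a: "renewal S u (int k - int ?a)" "\<And>e. e < ?a \<Longrightarrow> \<not> renewal S u (int k - int e)"
    using age_eq_iff[OF u, of S "int k" ?a] by auto
  have "?a \<le> k"
  proof (rule ccontr)
    assume "\<not> ?a \<le> k"
    then have "\<not> renewal S u (int k - int k)" by (intro a(2)) simp
    then show False using assms(2) by simp
  qed
  have "measure (law S) {x. (\<forall>i<Suc k. x (int i) = ?w i) \<and> x (int (Suc k))}
    = hazard S ?a * measure (law S) {x. \<forall>i<Suc k. x (int i) = ?w i}"
  proof (rule prefix_next_law)
    fix v assume v: "good v" and pre: "\<And>i. i < Suc k \<Longrightarrow> renewal S v (int i) = ?w i"
    have "renewal S v (int k - int e) = renewal S u (int k - int e)" if "e \<le> ?a" for e
    proof -
      have "int (k - e) = int k - int e" using that \<open>?a \<le> k\<close> by simp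
      moreover have "renewal S v (int (k - e)) = ?w (k - e)" by (rule pre) simp
      ultimately show ?thesis by (simp only: path_def)
    qed
    then have "renewal S v (int k - int ?a)" "\<forall>e<?a. \<not> renewal S v (int k - int e)"
      using a less_imp_le by simp_all
    then have "age S v (int k) = ?a"
      using age_eq_iff[OF v] by blast
    then show "age S v (int (Suc k) - 1) \<in> S \<longleftrightarrow> ?a \<in> S" by simp
  qed
  then show ?thesis
    using prefix_pos[where n = "Suc k" and w = ?w and S = S] unfolding pcond_def less_Suc_eq_le by simp
qed

section \<open>A continuous version of the conditional probability given the past\<close>

lemma dstar_less_imp_eq:
  assumes "dstar a b < (1 / 2) ^ Suc d" "i \<le> d"
  shows "a i = b i"
proof (rule ccontr)
  assume "a i \<noteq> b i"
  let ?f = "\<lambda>i. (1 / 2) ^ (i + 1) * (if a i = b i then 0 else 1 :: real)"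
  have "summable ?f"
    by (rule summable_comparison_test'[of "\<lambda>i. (1 / 2) ^ (i + 1)" 0]) auto
  then have "sum ?f {i} \<le> suminf ?f"
    by (intro sum_le_suminf) auto
  then have "(1 / 2) ^ Suc i \<le> dstar a b"
    using \<open>a i \<noteq> b i\<close> by (simp add: dstar_def)
  moreover have "(1 / 2 :: real) ^ Suc d \<le> (1 / 2) ^ Suc i"
    using assms(2) by (intro power_decreasing) auto
  ultimately show False using assms(1) by linarith
qed

text \<open>Pasts are indexed backwards from time 0, so the least index of a renewal is the age at
  time 0.\<close>

definition past_hazard :: "nat set \<Rightarrow> (nat \<Rightarrow> bool) \<Rightarrow> real" where
  "past_hazard S a = hazard S (LEAST d. a d)"

lemma measurable_past_hazard [measurable]: "past_hazard S \<in> borel_measurable BS1"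
  unfolding past_hazard_def by measurable

lemma past_hazard_renewal:
  assumes "good u" shows "past_hazard S (past (renewal S u)) = hazard S (age S u 0)"
  using age_eq_Least[OF assms, of S 0] by (simp add: past_hazard_def past_def)

lemma AE_past_renewal: "AE x in law S. \<exists>d. past x d"
proof -
  have "AE u in Om. \<exists>d. past (renewal S u) d"
    using AE_good
  proof eventually_elim
    fix u assume "good u"
    then have "renewal S u (0 - int (age S u 0))"
      using age_eq_iff[of u S 0 "age S u 0"] by blast
    then show "\<exists>d. past (renewal S u) d"
      by (intro exI[of _ "age S u 0"]) (simp add: past_def)
  qed
  moreover have "{x \<in> space BS. \<exists>d. past x d} \<in> sets BS"
    unfolding past_def by measurable
  ultimately show ?thesis
    unfolding law_def by (subst AE_distr_iff) auto
qed

text \<open>Where a renewal exists the function is locally constant: close pasts agree back to the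
  most recent renewal. The null set left out is the single past without renewals.\<close>

lemma dstar_continuous_past_hazard: "dstar_continuous_on {a. \<exists>d. a d} (past_hazard S)"
  unfolding dstar_continuous_on_def
proof (intro ballI allI impI)
  fix a :: "nat \<Rightarrow> bool" and e :: real assume "a \<in> {a. \<exists>d. a d}" "e > 0"
  then have a: "a (LEAST d. a d)" by (auto intro: LeastI)
  have "past_hazard S b = past_hazard S a" if "dstar a b < (1 / 2) ^ Suc (LEAST d. a d)" for b
  proof -
    have eq: "a i = b i" if "i \<le> (LEAST d. a d)" for i
      using dstar_less_imp_eq[OF \<open>dstar a b < _\<close> that] .
    have "(LEAST d. b d) = (LEAST d. a d)"
    proof (rule Least_equality)
      show "b (LEAST d. a d)" using a eq[OF order_refl] by (rule iffD1[rotated])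
      show "(LEAST d. a d) \<le> y" if "b y" for y
        using eq[of y] that by (metis Least_le nle_le)
    qed
    then show ?thesis by (simp add: past_hazard_def)
  qed
  then show "\<exists>d>0. \<forall>b\<in>{a. \<exists>d. a d}. dstar a b < d \<longrightarrow> \<bar>past_hazard S b - past_hazard S a\<bar> < e"
    using \<open>e > 0\<close> by (intro exI[of _ "(1 / 2) ^ Suc (LEAST d. a d)"]) auto
qed

text \<open>An event about the past is determined by the noise up to time 0, so
  \<open>prob_next\<close> applies at \<open>n = 0\<close>; the integrand is 1/3 on the event plus
  another 1/3 where the age lies in \<open>S\<close>.\<close>

lemma cond_prob_version_law: "cond_prob_version (law S) (past_hazard S)"
  unfolding cond_prob_version_def
proof (intro conjI ballI)
  interpret L: prob_space "law S" by (rule prob_space_law)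
  show "integrable (law S) (\<lambda>x. past_hazard S (past x))"
    by (rule L.integrable_const_bound[of _ 1]) (auto simp: past_hazard_def hazard_def)
  fix B assume B[measurable]: "B \<in> sets BS1"
  define A where "A = {u. past (renewal S u) \<in> B}"
  have A[measurable]: "A \<in> sets Om"
    unfolding A_def by measurable
  have dep: "depends_on A {..0}"
  proof (rule depends_onI)
    fix u v :: "int \<Rightarrow> nat" assume "\<And>i. i \<in> {..0} \<Longrightarrow> u i = v i"
    then have "renewal S u (- int i) = renewal S v (- int i)" for i
      by (intro renewal_cong) simp
    then have "past (renewal S u) = past (renewal S v)"
      by (simp add: past_def)
    then show "u \<in> A \<Longrightarrow> v \<in> A" by (simp add: A_def)
  qed
  have "(\<integral>x. indicator {x. past x \<in> B} x * past_hazard S (past x) \<partial>law S)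
    = (\<integral>u. indicator {x. past x \<in> B} (renewal S u) * past_hazard S (past (renewal S u)) \<partial>Om)"
  proof -
    have "past -` B \<inter> space BS \<in> sets BS" by measurable
    then have "{x. past x \<in> B} \<in> sets BS" by (simp add: vimage_def)
    then show ?thesis unfolding law_def by (intro integral_distr) measurable
  qed
  also have "\<dots> = (\<integral>u. indicator A u / 3 + indicator {u \<in> A. age S u 0 \<in> S} u / 3 \<partial>Om)"
  proof (rule integral_cong_AE)
    show "AE u in Om. indicator {x. past x \<in> B} (renewal S u) * past_hazard S (past (renewal S u))
      = indicator A u / 3 + indicator {u \<in> A. age S u 0 \<in> S} u / 3"
      using AE_good
      by eventually_elim (simp add: past_hazard_renewal A_def hazard_def indicator_def)
  next
    have "past -` B \<inter> space BS \<in> sets BS" by measurable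
    then have [measurable]: "{x. past x \<in> B} \<in> sets BS" by (simp add: vimage_def)
    show "(\<lambda>u. indicator {x. past x \<in> B} (renewal S u) * past_hazard S (past (renewal S u)))
      \<in> borel_measurable Om" by measurable
    show "(\<lambda>u. indicator A u / 3 + indicator {u \<in> A. age S u 0 \<in> S} u / 3 :: real)
      \<in> borel_measurable Om" by measurable
  qed
  also have "\<dots> = measure Om A / 3 + measure Om {u \<in> A. age S u 0 \<in> S} / 3"
    by (subst Bochner_Integration.integral_add) (auto simp: O.emeasure_eq_measure)
  also have "\<dots> = measure Om {u \<in> A. renewal S u 1}"
    using prob_next[OF A dep] by simp
  also have "\<dots> = measure (law S) {x. past x \<in> B \<and> x 1}"
  proof -
    have "{x \<in> space BS. past x \<in> B \<and> x 1} \<in> sets BS" by measurable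
    then show ?thesis by (subst measure_law) (auto simp: A_def)
  qed
  finally show "(\<integral>x. indicator {x. past x \<in> B} x * past_hazard S (past x) \<partial>law S)
    = measure (law S) {x. past x \<in> B \<and> x 1}" .
qed (rule measurable_past_hazard)

lemma as_continuous_law: "as_continuous (law S)"
  unfolding as_continuous_def
proof (intro exI conjI)
  show "AE x in law S. past x \<in> {a. \<exists>d. a d}"
    using AE_past_renewal by simp
qed (rule cond_prob_version_law dstar_continuous_past_hazard)+

subsection \<open>The adversary\<close>

lemma measurable_path_prefix:
  "(\<lambda>x. map (path x) [0..<k]) \<in> measurable BS (count_space UNIV)"
proof (induction k)
  case (Suc k)
  have "(\<lambda>x. path x k) \<in> measurable BS (count_space UNIV)"
    unfolding path_def by measurable
  from measurable_count_space_binop[OF Suc this, of "\<lambda>l b. l @ [b]"]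
  show ?case by simp
qed simp

text \<open>Prefixes live in a countable discrete space, so an arbitrary \<open>F\<close>, and hence
  an arbitrary estimator, is admissible.\<close>

lemma measurable_path_prefix_fun:
  "(\<lambda>x. F (map (path x) [0..<k])) \<in> measurable BS (count_space UNIV)"
  by (rule measurable_compose[OF measurable_path_prefix]) simp

lemma pcond_cong:
  assumes "\<And>i. i \<le> k \<Longrightarrow> x i = y i" shows "pcond \<mu> k x = pcond \<mu> k y"
  unfolding pcond_def using assms by (simp cong: conj_cong)

text \<open>The hazard lies across 1/2 from the estimate, and both 1/3 and 2/3 are at distance 1/6
  from 1/2.\<close>

lemma hazard_misses:
  assumes "e < 1 / 2 \<longleftrightarrow> L \<in> S"
  shows "1 / 6 \<le> \<bar>e - hazard S L\<bar>"
  using assms by (cases "L \<in> S") (auto simp: hazard_def abs_if)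

text \<open>The rules are indexed from 1 and \<open>stopping_seq\<close> does not constrain
  \<open>lam 0\<close>, so the stopping times below appear as \<open>lam (Suc m)\<close>.\<close>

locale stopped_estimator =
  fixes lam :: "nat \<Rightarrow> (nat \<Rightarrow> bool) \<Rightarrow> nat" and h :: "nat \<Rightarrow> bool list \<Rightarrow> real"
  assumes stopping: "stopping_seq lam"
begin

lemma lam_cong:
  assumes "\<And>i. i \<le> lam (Suc m) x \<Longrightarrow> x i = y i"
  shows "lam (Suc m) y = lam (Suc m) x"
proof -
  have "\<forall>x y. (\<forall>i\<le>lam (Suc m) x. x i = y i) \<longrightarrow> lam (Suc m) y = lam (Suc m) x"
    using stopping unfolding stopping_seq_def by simp
  then show ?thesis using assms by blast
qed

text \<open>Once all increments equal 1, the sequence runs through every later time.\<close>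

lemma lam_covers:
  assumes "\<forall>\<^sub>F n in sequentially. lam (Suc n) x = lam n x + 1"
  shows "\<exists>N. \<forall>t\<ge>N. \<exists>m. lam (Suc m) x = t"
proof -
  obtain n where n: "\<And>k. k \<ge> n \<Longrightarrow> lam (Suc k) x = lam k x + 1"
    using assms unfolding eventually_sequentially by blast
  have "lam (Suc (n + k)) x = lam (Suc n) x + k" for k
    by (induction k) (use n in auto)
  then have "\<exists>m. lam (Suc m) x = t" if "t \<ge> lam (Suc n) x" for t
    using that by (metis le_add_diff_inverse)
  then show ?thesis by blast
qed

lemma measurable_lam [measurable]:
  "(\<lambda>x. lam (Suc m) (path x)) \<in> measurable BS (count_space UNIV)"
proof -
  have "{x. lam (Suc m) (path x) = k} \<in> sets BS" for k
  proof -
    \<comment> \<open>The prefix up to \<open>k\<close> is extended by list lookup. The unspecified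
      values beyond it are harmless, since whether the rule stops at \<open>k\<close> is decided by
      the coordinates up to \<open>k\<close>.\<close>
    let ?y = "\<lambda>x i. map (path x) [0..<Suc k] ! i"
    have y: "?y x i = path x i" if "i \<le> k" for x i
      using nth_map_upt[of i "Suc k" 0 "path x"] that by simp
    have "lam (Suc m) (path x) = k \<longleftrightarrow> lam (Suc m) (?y x) = k" for x
    proof
      assume *: "lam (Suc m) (path x) = k"
      then have "lam (Suc m) (?y x) = lam (Suc m) (path x)"
        by (intro lam_cong) (metis y)
      then show "lam (Suc m) (?y x) = k" using * by metis
    next
      assume *: "lam (Suc m) (?y x) = k"
      then have "lam (Suc m) (path x) = lam (Suc m) (?y x)"
        by (intro lam_cong) (metis y)
      then show "lam (Suc m) (path x) = k" using * by metis
    qed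
    then have "{x. lam (Suc m) (path x) = k} = (\<lambda>x. lam (Suc m) (?y x)) -` {k} \<inter> space BS"
      by auto
    also have "\<dots> \<in> sets BS"
      by (rule measurable_sets[OF measurable_path_prefix_fun[of "\<lambda>l. lam (Suc m) (\<lambda>i. l ! i)"]]) simp
    finally show ?thesis .
  qed
  then show ?thesis
    by (subst measurable_count_space_eq2_countable) (auto simp: vimage_def)
qed

lemma measurable_error:
  "(\<lambda>x. ereal \<bar>h n (map (path x) [0..<Suc (lam (Suc m) (path x))])
    - pcond \<mu> (lam (Suc m) (path x)) (path x)\<bar>) \<in> borel_measurable BS"
proof -
  define F where "F k l = ereal \<bar>h n l - pcond \<mu> k (\<lambda>i. l ! i)\<bar>" for k l
  define f where "f k x = F k (map (path x) [0..<Suc k])" for k x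
  have "f k \<in> borel_measurable BS" for k
    unfolding f_def by (rule measurable_compose[OF measurable_path_prefix]) simp
  from measurable_compose_countable[of f, OF this measurable_lam]
  have "(\<lambda>x. f (lam (Suc m) (path x)) x) \<in> borel_measurable BS" .
  moreover have "pcond \<mu> k (\<lambda>i. map (path x) [0..<Suc k] ! i) = pcond \<mu> k (path x)" for k x
  proof (rule pcond_cong)
    fix i assume "i \<le> k"
    then show "map (path x) [0..<Suc k] ! i = path x i"
      using nth_map_upt[of i "Suc k" 0 "path x"] by simp
  qed
  ultimately show ?thesis by (simp only: f_def F_def)
qed

text \<open>The trap springs when the age first reaches the level L at a time observed by the stopping
  sequence; b records on which side of 1/2 the estimate lies. At that moment no age above L has
  occurred yet, so the event does not depend on which ages from L on belong to the set.\<close>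

definition trap :: "nat set \<Rightarrow> nat \<Rightarrow> bool \<Rightarrow> (int \<Rightarrow> nat) set" where
  "trap S L b = {u. u 0 = 0 \<and> (\<exists>t m. age S u (int t) = L \<and> (\<forall>s<t. age S u (int s) \<noteq> L) \<and>
     lam (Suc m) (path (renewal S u)) = t \<and>
     (h (Suc m) (map (path (renewal S u)) [0..<Suc t]) < 1 / 2 \<longleftrightarrow> b))}"

lemma measurable_lam_renewal [measurable]:
  "(\<lambda>u. lam (Suc m) (path (renewal S u))) \<in> measurable Om (count_space UNIV)"
  by (rule measurable_compose[OF measurable_renewal measurable_lam])

lemma measurable_h_renewal [measurable]:
  "Measurable.pred Om (\<lambda>u. h m (map (path (renewal S u)) [0..<k]) < 1 / 2)"
  by (rule measurable_compose[OF measurable_renewal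
        measurable_path_prefix_fun[of "\<lambda>l. h m l < 1 / 2"]])

lemma sets_trap [measurable]: "trap S L b \<in> sets Om"
  unfolding trap_def by measurable

text \<open>Up to the first visit to \<open>L\<close> the two paths coincide, and the stopping rule
  and the estimate see only that segment. This moves a trap from a finite stage of the construction
  to the limit set.\<close>

lemma trap_transfer:
  assumes u: "good u" "u \<in> trap S L b" and S: "S \<inter> {..<L} = S' \<inter> {..<L}"
  shows "u \<in> trap S' L b"
proof -
  obtain t m where u0: "u 0 = 0"
    and t: "age S u (int t) = L" "\<And>s. s < t \<Longrightarrow> age S u (int s) \<noteq> L"
    and m: "lam (Suc m) (path (renewal S u)) = t"
    and b: "h (Suc m) (map (path (renewal S u)) [0..<Suc t]) < 1 / 2 \<longleftrightarrow> b"
    using u(2) unfolding trap_def by blast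
  have eq: "age S' u (int s) = age S u (int s)" if "s \<le> t" for s
    by (rule age_agree[OF u(1) u0 S t(2) that])
  then have path: "path (renewal S' u) s = path (renewal S u) s" if "s \<le> t" for s
    using that by (simp add: path_def renewal_def)
  have "lam (Suc m) (path (renewal S' u)) = lam (Suc m) (path (renewal S u))"
    by (rule lam_cong) (simp only: m path)
  then have m': "lam (Suc m) (path (renewal S' u)) = t"
    by (simp only: m)
  have map: "map (path (renewal S' u)) [0..<Suc t] = map (path (renewal S u)) [0..<Suc t]"
    by (rule map_cong[OF refl]) (rule path, auto)
  have b': "h (Suc m) (map (path (renewal S' u)) [0..<Suc t]) < 1 / 2 \<longleftrightarrow> b"
    using b by (simp only: map)
  have t': "age S' u (int t) = L"
    using t(1) eq[of t] by simp
  have "age S' u (int s) \<noteq> L" if "s < t" for s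
    using t(2)[OF that] eq[of s] that by simp
  then show ?thesis
    using u0 m' b' t' unfolding trap_def by blast
qed

text \<open>When the trap springs the age is \<open>L\<close>, so the true probability is
  \<open>hazard S L\<close>, placed by \<open>b\<close> across 1/2 from the estimate. The bound on
  the stopping time later shows that errors occur arbitrarily late.\<close>

lemma trap_error:
  assumes u: "good u" "u \<in> trap S L b" and b: "L \<in> S \<longleftrightarrow> b"
  shows "\<exists>m. L \<le> lam (Suc m) (path (renewal S u)) \<and>
    1 / 6 \<le> \<bar>h (Suc m) (map (path (renewal S u)) [0..<Suc (lam (Suc m) (path (renewal S u)))])
      - pcond (law S) (lam (Suc m) (path (renewal S u))) (path (renewal S u))\<bar>"
proof -
  obtain t m where u0: "u 0 = 0" and t: "age S u (int t) = L"
    and m: "lam (Suc m) (path (renewal S u)) = t"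
    and h: "h (Suc m) (map (path (renewal S u)) [0..<Suc t]) < 1 / 2 \<longleftrightarrow> b"
    using u(2) unfolding trap_def by blast
  have "age S u 0 = 0" using age_le[OF u(1) u0, of S 0] by simp
  then have "pcond (law S) t (path (renewal S u)) = hazard S L"
    using pcond_law[OF u(1), of S t] t by (simp add: renewal_def)
  moreover have "L \<le> t" using age_le[OF u(1) u0, of S t] t by simp
  moreover have "1 / 6 \<le> \<bar>h (Suc m) (map (path (renewal S u)) [0..<Suc t]) - hazard S L\<bar>"
    by (rule hazard_misses) (simp only: h b)
  ultimately show ?thesis
    unfolding m[symmetric] by (intro exI[of _ m]) (simp only: simp_thms)
qed

text \<open>Somewhere there are \<open>L\<close> consecutive noise values 2. They forbid renewals,
  so the age climbs to at least \<open>L\<close> and has passed through \<open>L\<close>.\<close>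

lemma AE_age_attains:
  "AE u in Om. u 0 = 0 \<longrightarrow> (\<exists>t. age S u (int t) = L)"
proof -
  let ?B = "{u. \<forall>i\<in>{1..int L}. u i \<in> {2}}"
  have "measure Om ?B = (\<Prod>i\<in>{1..int L}. 1 / 3)"
    by (subst measure_Om_cylinder) (auto simp: measure_M3)
  then have "measure Om ?B > 0" by (simp add: prod_pos)
  then have "AE u in Om. \<forall>m. \<exists>n\<ge>m. (\<lambda>i. u (i + int n)) \<in> ?B"
    by (intro AE_Om_infinitely_often sets_cylinder) auto
  then show ?thesis
    using AE_good
  proof eventually_elim
    fix u assume *: "\<forall>m. \<exists>n\<ge>m. (\<lambda>i. u (i + int n)) \<in> ?B" and u: "good u"
    obtain n where "(\<lambda>i. u (i + int n)) \<in> ?B"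
      using *[rule_format, of 0] by (elim exE conjE)
    then have n: "u (i + int n) = 2" if "i \<in> {1..int L}" for i
      using that by simp
    have "j \<le> L \<Longrightarrow> j \<le> age S u (int (n + j))" for j
    proof (induction j)
      case (Suc j)
      then show ?case
        using n[of "int (Suc j)"] age_step[OF u, of S "int (n + j)"] by (simp add: algebra_simps)
    qed simp
    from this[of L] show "u 0 = 0 \<longrightarrow> (\<exists>t. age S u (int t) = L)"
      using age_attains[OF u, of L S "n + L"] by auto
  qed
qed

text \<open>The level L needs L steps from a renewal to be reached, so it suffices to take L beyond the
  time after which, with high probability, every time is observed.\<close>

lemma trap_exists:
  assumes "AE x in law S. \<forall>\<^sub>F n in sequentially. lam (Suc n) (path x) = lam n (path x) + 1"
    and "finite S"
  shows "\<exists>L b. K < L \<and> S \<subseteq> {..<L} \<and> 1 / 8 \<le> measure Om (trap S L b)"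
proof -
  define F where "F N = {u. u 0 = 0 \<and> (\<forall>t\<ge>N. \<exists>m. lam (Suc m) (path (renewal S u)) = t)}" for N
  have F[measurable]: "F N \<in> sets Om" for N
    unfolding F_def by measurable
  have "(\<lambda>N. measure Om (F N)) \<longlonglongrightarrow> measure Om (\<Union>N. F N)"
    by (rule O.finite_Lim_measure_incseq) (auto simp: F_def incseq_def)
  moreover have "measure Om (\<Union>N. F N) = measure Om {u. \<forall>i\<in>{0}. u i \<in> {0}}"
  proof (rule measure_eq_AE)
    show "AE u in Om. u \<in> (\<Union>N. F N) \<longleftrightarrow> u \<in> {u. \<forall>i\<in>{0}. u i \<in> {0}}"
      using AE_law[OF assms(1)]
    proof eventually_elim
      fix u assume "\<forall>\<^sub>F n in sequentially.
        lam (Suc n) (path (renewal S u)) = lam n (path (renewal S u)) + 1"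
      from lam_covers[OF this]
      show "u \<in> (\<Union>N. F N) \<longleftrightarrow> u \<in> {u. \<forall>i\<in>{0}. u i \<in> {0}}"
        by (auto simp: F_def)
    qed
  qed (auto intro: sets_cylinder)
  moreover have "measure Om {u. \<forall>i\<in>{0}. u i \<in> {0}} = 1 / 3"
    by (subst measure_Om_cylinder) (auto simp: measure_M3)
  ultimately have "(\<lambda>N. measure Om (F N)) \<longlonglongrightarrow> 1 / 3" by (simp only:)
  then have "\<forall>\<^sub>F N in sequentially. 1 / 4 < measure Om (F N)"
    by (rule order_tendstoD) simp
  \<comment> \<open>The value 1/4 lies below the limit 1/3, the probability of a zero at time 0; one
    of the two sides of the estimate then receives at least 1/8.\<close>
  then obtain N where N: "1 / 4 < measure Om (F N)"
    unfolding eventually_sequentially by blast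
  obtain B where B: "S \<subseteq> {..<B}"
    using finite_nat_iff_bounded assms(2) by blast
  \<comment> \<open>The summand \<open>K\<close> puts the level past the earlier ones,
    \<open>N\<close> past the time from which every time is observed, and \<open>B\<close> above all
    of \<open>S\<close>.\<close>
  define L where "L = Suc (K + N + B)"
  have "measure Om (F N) \<le> measure Om (trap S L True \<union> trap S L False)"
  proof (rule O.finite_measure_mono_AE)
    show "AE u in Om. u \<in> F N \<longrightarrow> u \<in> trap S L True \<union> trap S L False"
      using AE_age_attains[of S L] AE_good
    proof eventually_elim
      fix u assume hit: "u 0 = 0 \<longrightarrow> (\<exists>t. age S u (int t) = L)" and u: "good u"
      show "u \<in> F N \<longrightarrow> u \<in> trap S L True \<union> trap S L False"
      proof
        assume "u \<in> F N"
        then have u0: "u 0 = 0" and N: "\<And>t. t \<ge> N \<Longrightarrow> \<exists>m. lam (Suc m) (path (renewal S u)) = t"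
          by (auto simp: F_def)
        define t where "t = (LEAST t. age S u (int t) = L)"
        have t: "age S u (int t) = L" "\<forall>s<t. age S u (int s) \<noteq> L"
          unfolding t_def using hit u0 by (auto intro: LeastI dest: not_less_Least)
        have "L \<le> t" using age_le[OF u u0, of S t] t by simp
        then obtain m where "lam (Suc m) (path (renewal S u)) = t"
          using N[of t] by (auto simp: L_def)
        then show "u \<in> trap S L True \<union> trap S L False"
          using u0 t unfolding trap_def by blast
      qed
    qed
  qed auto
  also have "\<dots> \<le> measure Om (trap S L True) + measure Om (trap S L False)"
    by (intro measure_Un_le) auto
  finally have "1 / 8 \<le> measure Om (trap S L True) \<or> 1 / 8 \<le> measure Om (trap S L False)"
    using N by linarith
  moreover have "K < L" "S \<subseteq> {..<L}"
    using B by (auto simp: L_def)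
  ultimately show ?thesis by blast
qed

text \<open>A stage consists of a finite set, a level above it and the side \<open>b\<close> of the
  estimate; the next set receives the level exactly if \<open>b\<close> holds. Later stages add only
  higher levels, so the union \<open>T\<close> leaves each trap intact.\<close>

lemma trap_sequence:
  assumes "\<And>S. finite S \<Longrightarrow>
    AE x in law S. \<forall>\<^sub>F n in sequentially. lam (Suc n) (path x) = lam n (path x) + 1"
  shows "\<exists>T L b. (\<forall>k. k \<le> L k \<and> (L k \<in> T \<longleftrightarrow> b k) \<and>
    1 / 8 \<le> measure Om (trap T (L k) (b k)))"
proof -
  let ?P = "\<lambda>(k :: nat) (S, L, b). finite S \<and> S \<subseteq> {..<L} \<and> 1 / 8 \<le> measure Om (trap S L b)"
  let ?Q = "\<lambda>(k :: nat) (S, L, b) (S', L', b'). S' = (if b then insert L S else S) \<and> L < (L' :: nat)"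
  have "\<exists>f. \<forall>k. ?P k (f k) \<and> ?Q k (f k) (f (Suc k))"
  proof (rule dependent_nat_choice)
    obtain L b where "{} \<subseteq> {..<L}" "1 / 8 \<le> measure Om (trap {} L b)"
      using trap_exists[OF assms, of "{}"] by blast
    then show "\<exists>x. ?P 0 x"
      by (intro exI[of _ "({}, L, b)"]) simp
  next
    fix x k assume P: "?P k x"
    obtain S L b where x: "x = (S, L, b)" by (cases x)
    define S' where "S' = (if b then insert L S else S)"
    have S': "finite S'" using P by (simp add: S'_def x)
    then obtain L' b' where "L < L'" "S' \<subseteq> {..<L'}" "1 / 8 \<le> measure Om (trap S' L' b')"
      using trap_exists[OF assms, of S' L] by blast
    then show "\<exists>y. ?P (Suc k) y \<and> ?Q k x y"
      using S' by (intro exI[of _ "(S', L', b')"]) (simp add: x S'_def)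
  qed
  then obtain f where f: "\<forall>k. ?P k (f k) \<and> ?Q k (f k) (f (Suc k))" ..
  define S where "S k = fst (f k)" for k
  define L where "L k = fst (snd (f k))" for k
  define b where "b k = snd (snd (f k))" for k
  have SL: "S k \<subseteq> {..<L k}" and P: "1 / 8 \<le> measure Om (trap (S k) (L k) (b k))"
    and S_Suc: "S (Suc k) = (if b k then insert (L k) (S k) else S k)" and L_Suc: "L k < L (Suc k)" for k
    using f[THEN spec, of k] by (auto simp: S_def L_def b_def split: prod.splits if_splits)
  have L: "strict_mono L" using L_Suc by (simp add: strict_mono_Suc_iff)
  have S_mono: "S i \<subseteq> S j" if "i \<le> j" for i j
    using that by (rule lift_Suc_mono_le[rotated]) (auto simp: S_Suc)
  have S_stable: "x \<in> S k" if "x \<in> S j" "x < L k" for x j k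
  proof (cases "j \<le> k")
    case True
    then show ?thesis using S_mono that by blast
  next
    case False
    then obtain d where j: "j = k + d" by (metis nat_le_linear le_iff_add)
    have "x \<in> S (k + d) \<Longrightarrow> x \<in> S k" for d
    proof (induction d)
      case (Suc d)
      have "L k \<le> L (k + d)" using L by (simp add: strict_mono_less_eq)
      then show ?case using Suc that(2) by (auto simp: S_Suc split: if_splits)
    qed simp
    then show ?thesis using that(1) j by blast
  qed
  define T where "T = (\<Union>k. S k)"
  have T: "S k \<inter> {..<L k} = T \<inter> {..<L k}" for k
    using S_stable by (auto simp: T_def)
  have "L k \<in> T \<longleftrightarrow> b k" for k
  proof
    assume "L k \<in> T"
    then have "L k \<in> S (Suc k)" using S_stable L_Suc by (auto simp: T_def)
    then show "b k" using SL[of k] by (auto simp: S_Suc split: if_splits)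
  next
    assume "b k"
    then have "L k \<in> S (Suc k)" by (simp add: S_Suc)
    then show "L k \<in> T" by (auto simp: T_def)
  qed
  moreover have "1 / 8 \<le> measure Om (trap T (L k) (b k))" for k
  proof -
    have "measure Om (trap (S k) (L k) (b k)) \<le> measure Om (trap T (L k) (b k))"
    proof (rule O.finite_measure_mono_AE)
      show "AE u in Om. u \<in> trap (S k) (L k) (b k) \<longrightarrow> u \<in> trap T (L k) (b k)"
        using AE_good by eventually_elim (intro impI trap_transfer[OF _ _ T])
    qed (rule sets_trap)
    then show ?thesis using P[of k] by linarith
  qed
  moreover have "k \<le> L k" for k
    using L by (rule strict_mono_imp_increasing)
  ultimately show ?thesis
    by (intro exI[of _ T] exI[of _ L] exI[of _ b] allI conjI)
qed

end

section \<open>Infinitely many errors for the limit process\<close>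

theorem theorem1:
  fixes lam :: "nat \<Rightarrow> (nat \<Rightarrow> bool) \<Rightarrow> nat"
    and h :: "nat \<Rightarrow> bool list \<Rightarrow> real"
  assumes "stopping_seq lam"
    and "\<forall>\<mu>. stationary \<mu> \<and> ergodic \<mu> \<and> markov_finite_order \<mu> \<longrightarrow>
           (AE x in \<mu>. \<forall>\<^sub>F n in sequentially. lam (Suc n) (path x) = lam n (path x) + 1)"
  shows "\<exists>\<mu>. stationary \<mu> \<and> ergodic \<mu> \<and> as_continuous \<mu> \<and>
           measure \<mu> {x \<in> space \<mu>.
              limsup (\<lambda>n. ereal \<bar>h n (map (path x) [0..<Suc (lam n (path x))])
                                   - pcond \<mu> (lam n (path x)) (path x)\<bar>) > 0} > 0"
proof -
  interpret stopped_estimator lam h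
    using assms(1) by unfold_locales
  have "AE x in law S. \<forall>\<^sub>F n in sequentially. lam (Suc n) (path x) = lam n (path x) + 1"
    if "finite S" for S
    using assms(2) stationary_law ergodic_law markov_law[OF that] by blast
  from trap_sequence[OF this]
  obtain T L b where L: "\<And>k. k \<le> L k" and b: "\<And>k. L k \<in> T \<longleftrightarrow> b k"
    and trap: "\<And>k. 1 / 8 \<le> measure Om (trap T (L k) (b k))"
    by blast
  define err where "err x n = ereal \<bar>h n (map (path x) [0..<Suc (lam n (path x))])
    - pcond (law T) (lam n (path x)) (path x)\<bar>" for x n
  define G where "G = {x \<in> space (law T). limsup (err x) > 0}"
  \<comment> \<open>Dropping index 0 leaves the limsup unchanged and avoids \<open>lam 0\<close>,
    whose measurability is not known.\<close>
  have "(\<lambda>x. limsup (\<lambda>n. err x (Suc n))) \<in> borel_measurable BS"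
    unfolding err_def by (intro borel_measurable_limsup measurable_error)
  then have [measurable]: "(\<lambda>x. limsup (err x)) \<in> borel_measurable BS"
    using limsup_shift[of "err _"] by (simp cong: measurable_cong)
  have G: "G \<in> sets BS"
  proof -
    have "{x \<in> space BS. limsup (err x) > 0} \<in> sets BS" by measurable
    then show ?thesis by (simp add: G_def)
  qed
  \<comment> \<open>The sets \<open>V m\<close> decrease and each contains a trap of probability at
    least 1/8, so with probability at least 1/8 infinitely many traps spring.\<close>
  define V where "V m = (\<Union>k\<in>{m..}. trap T (L k) (b k))" for m :: nat
  have V[measurable]: "V m \<in> sets Om" for m unfolding V_def by measurable
  have "1 / 8 \<le> measure Om (V m)" for m
  proof -
    have "measure Om (trap T (L m) (b m)) \<le> measure Om (V m)"
      by (intro O.finite_measure_mono) (auto simp: V_def)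
    then show ?thesis using trap[of m] by linarith
  qed
  moreover have "(\<lambda>m. measure Om (V m)) \<longlonglongrightarrow> measure Om (\<Inter>m. V m)"
    by (rule O.finite_Lim_measure_decseq) (auto simp: V_def decseq_def intro: order_trans)
  ultimately have "1 / 8 \<le> measure Om (\<Inter>m. V m)"
    by (intro LIMSEQ_le_const) auto
  also have "\<dots> \<le> measure Om {u. renewal T u \<in> G}"
  proof (rule O.finite_measure_mono_AE)
    show "AE u in Om. u \<in> (\<Inter>m. V m) \<longrightarrow> u \<in> {u. renewal T u \<in> G}"
      using AE_good
    proof eventually_elim
      fix u assume u: "good u"
      let ?x = "renewal T u"
      have "limsup (err ?x) > 0" if V: "u \<in> (\<Inter>m. V m)"
      proof (rule ccontr)
        assume "\<not> limsup (err ?x) > 0"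
        then have "limsup (err ?x) \<le> 0" by simp
        also have "0 < ereal (1 / 6)" by simp
        finally have "\<forall>\<^sub>F n in sequentially. err ?x n < ereal (1 / 6)"
          by (rule Limsup_lessD)
        then obtain N where N: "\<And>n. n \<ge> N \<Longrightarrow> err ?x n < ereal (1 / 6)"
          unfolding eventually_sequentially by blast
        \<comment> \<open>A trap level above the sum of all stopping times with index below
          \<open>N\<close> cannot spring at such an index, since that stopping time would be one of
          the summands.\<close>
        have "u \<in> V (Suc (\<Sum>n<N. lam n (path ?x)))" using V by blast
        then obtain k where "k \<in> {Suc (\<Sum>n<N. lam n (path ?x))..}" and "u \<in> trap T (L k) (b k)"
          unfolding V_def by (elim UN_E)
        then have k: "(\<Sum>n<N. lam n (path ?x)) < k" by (simp only: atLeast_iff Suc_le_eq)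
        from trap_error[OF u \<open>u \<in> trap T (L k) (b k)\<close> b] obtain m where m: "L k \<le> lam (Suc m) (path ?x)"
          and "ereal (1 / 6) \<le> err ?x (Suc m)"
          unfolding err_def ereal_less_eq by blast
        then have "Suc m < N" using N by (meson not_le)
        then have "lam (Suc m) (path ?x) \<le> (\<Sum>n<N. lam n (path ?x))"
          by (intro member_le_sum) auto
        then show False using m L[of k] k by linarith
      qed
      then show "u \<in> (\<Inter>m. V m) \<longrightarrow> u \<in> {u. renewal T u \<in> G}"
        by (simp add: G_def)
    qed
    have "renewal T -` G \<inter> space Om \<in> sets Om"
      by (rule measurable_sets[OF measurable_renewal G])
    then show "{u. renewal T u \<in> G} \<in> sets Om" by (simp add: vimage_def)
  qed
  also have "\<dots> = measure (law T) G" by (simp add: measure_law G)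
  finally have "measure (law T) G > 0" by simp
  then show ?thesis
    using stationary_law[of T] ergodic_law[of T] as_continuous_law[of T]
    unfolding G_def err_def by blast
qed

end
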